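(* Let $\gamma>0$, $c\ge1$, and let $S^{\rm Tok}(t;c,\gamma)$ be the critical Tokunaga branching process. Then, for every $k\ge1$, $$\lim_{K\to\infty}\frac{\mathcal{V}_k[K]}{\mathcal{V}_1[K]}=2^{1-k}.$$ Let $T=\mathrm{shape}(T[S^{\rm Tok}])\in\mathcal{H}_K$ be a tree generated by $\mu_K$, and let $v$ be a vertex selected by uniform random drawing from the non-root vertices of $T$. Then, for every $k\ge1$, $$\lim_{K\to\infty}\mathsf{P}(v\text{ has order }k)=p_k=2^{-k}.$$
   Context: Trees. $\mathcal{T}$ is the space of finite unlabeled rooted reduced planted binary trees with no planar embedding (the root has degree 1, internal vertices have degree 3, leaves have degree 1), together with the empty tree $\phi$ (a single root vertex). $\mathcal{L}$ is the space of trees from $\mathcal{T}$ with positive edge lengths; $\mathrm{shape}:\mathcal{L}\to\mathcal{T}$ forgets the lengths. Pruning $\mathcal{R}$ removes leaves with their parental edges and then performs series reduction (each degree-two vertex is removed by merging its two adjacent edges); $\mathcal{R}(\phi)=\phi$. The (Horton-Strahler) order of a tree is $\mathsf{k}(T)=\min\{k\ge0:\mathcal{R}^k(T)=\phi\}$, and $\mathcal{H}_K\subset\mathcal{T}$ is the set of trees of order $K$. The order of a non-root vertex $v$ is the order of the subtree rooted at the parent of $v$ and comprised of $v$ and all its descendants with their parental edges. Hierarchical branching process. Given nonnegative $\{T_k\}_{k\ge1}$, positive $\{\lambda_j\}_{j\ge1}$ and a probability mass function $\{p_K\}_{K\ge1}$, $S=(\{T_k\},\{\lambda_j\},\{p_K\})$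 is the multi-type continuous-time branching process that starts with a single root branch of order $K$ with probability $p_K$. Independently of the other branches, every branch of order $j$ produces offspring branches of each order $i<j$ with rate $\lambda_jT_{j-i}$, and terminates with rate $\lambda_j$. After termination, a branch of order $j\ge2$ splits into two branches of order $j-1$; a branch of order 1 terminates without leaving offspring. The branching history creates a random tree $T[S]\in\mathcal{L}$. The critical Tokunaga branching process $S^{\rm Tok}(t;c,\gamma)$ has parameters $\lambda_j=\gamma c^{2-j}$, $p_K=2^{-K}$, $T_k=(c-1)c^{k-1}$. $\mu$ is the measure on $\mathcal{T}$ induced by $S^{\rm Tok}(t;c,\gamma)$, $\mu(\tau)=\mathsf{P}(\mathrm{shape}(T[S^{\rm Tok}])=\tau)$, and $\mu_K(\tau)=\mu(\tau\mid\tau\in\mathcal{H}_K)$. $V_k[K]$ is the number of (non-root) vertices of order $k\in\{1,\dots,K\}$ in a tree generated by $\mu_K$, and $\mathcal{V}_k[K]=\mathsf{E}(V_k[K])$. *)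

theory Defs
  imports "HOL-Probability.Probability" "HOL-Library.Multiset"
begin

text \<open>A rooted tree is the multiset of the subtrees hanging below its root vertex.\<close>

datatype rtree = Vertex "rtree multiset"

definition empty_tree :: rtree
  where "empty_tree = Vertex {#}"

lemma size_child_less [termination_simp]:
  "t \<in># M \<Longrightarrow> size t < Suc (size_multiset size M)"
  by (auto simp: size_multiset_overloaded_def dest!: multi_member_split)

inductive binary_below :: "rtree \<Rightarrow> bool" where
  leaf: "binary_below (Vertex {#})"
| internal: "binary_below a \<Longrightarrow> binary_below b \<Longrightarrow> binary_below (Vertex {#a, b#})"

text \<open>Reduced planted binary trees: the root has exactly one child, and every
  other vertex has either no children (degree 1) or two children (degree 3).\<close>

definition binary_trees :: "rtree set"
  where "binary_trees = insert empty_tree {Vertex {#v#} | v. binary_below v}"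

text \<open>The root is never a leaf, so it survives even when all its children are removed.\<close>

fun cut_leaves :: "rtree \<Rightarrow> rtree" where
  "cut_leaves (Vertex M) = Vertex (image_mset cut_leaves {#t \<in># M. t \<noteq> Vertex {#}#})"

text \<open>The argument of \<open>reduce_below\<close> is a subtree attached to a parent, so its top
  vertex has degree two iff it has exactly one child.\<close>

primrec reduce_below :: "rtree \<Rightarrow> rtree" where
  "reduce_below (Vertex M) =
     (let N = image_mset reduce_below M
      in if size N = 1 then the_elem (set_mset N) else Vertex N)"

primrec series_reduction :: "rtree \<Rightarrow> rtree" where
  "series_reduction (Vertex M) = Vertex (image_mset reduce_below M)"

definition prune :: "rtree \<Rightarrow> rtree"
  where "prune t = series_reduction (cut_leaves t)"

definition hs_order :: "rtree \<Rightarrow> nat"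
  where "hs_order t = (LEAST k. (prune ^^ k) t = empty_tree)"

definition trees_of_order :: "nat \<Rightarrow> rtree set"
  where "trees_of_order K = {t \<in> binary_trees. hs_order t = K}"

text \<open>Each non-root vertex is represented, with multiplicity, by the subtree of its
  descendants.\<close>

primrec nonroot_vertices :: "rtree \<Rightarrow> rtree multiset" where
  "nonroot_vertices (Vertex M) = M + \<Sum>\<^sub># (image_mset nonroot_vertices M)"

text \<open>The additional top vertex below is the parent of \<open>v\<close>.\<close>

definition vertex_order :: "rtree \<Rightarrow> nat"
  where "vertex_order v = hs_order (Vertex {#v#})"

definition num_vertices :: "nat \<Rightarrow> rtree \<Rightarrow> nat"
  where "num_vertices k t = size {#v \<in># nonroot_vertices t. vertex_order v = k#}"

text \<open>Each subtree comes with the length of the edge that connects it to its parent.\<close>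

datatype ltree = LVertex "(real \<times> ltree) multiset"

primrec tree_shape :: "ltree \<Rightarrow> rtree" where
  "tree_shape (LVertex M) = Vertex (image_mset snd (image_mset (map_prod id tree_shape) M))"

text \<open>A branch is identified by its line of descent, most recent step first:
  \<open>Side i n\<close> is the \<open>n\<close>-th offspring of order \<open>i\<close> produced during the life of the parent,
  \<open>Split b\<close> is one of the two branches created when the parent terminates.

  All randomness besides the order of the root branch comes from independent
  exponential clocks of rate 1: \<open>Life u\<close>, divided by the termination rate, is the lifetime
  of branch \<open>u\<close>, and
  \<open>Gap u i n\<close> are the successive interarrival times of the unit rate Poisson process
  from which the births of offspring of order \<open>i\<close> by branch \<open>u\<close> are obtained.\<close>

datatype descent = Side nat nat | Split bool

datatype clock = Life "descent list" | Gap "descent list" nat nat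

text \<open>In what follows \<open>T\<close>, \<open>lam\<close> and \<open>p\<close> are the parameters of the process; they are
  indexed from 1, and the values at 0 are irrelevant.\<close>

definition hbp_space :: "(nat \<Rightarrow> real) \<Rightarrow> (nat \<times> (clock \<Rightarrow> real)) measure" where
  "hbp_space p =
     point_measure {1..} (\<lambda>K. ennreal (p K)) \<Otimes>\<^sub>M
     (\<Pi>\<^sub>M x\<in>UNIV. density lborel (\<lambda>t. ennreal (exponential_density 1 t)))"

definition lifetime ::
  "(nat \<Rightarrow> real) \<Rightarrow> (clock \<Rightarrow> real) \<Rightarrow> nat \<Rightarrow> descent list \<Rightarrow> real"
  where "lifetime lam \<omega> j u = \<omega> (Life u) / lam j"

definition offspring_rate ::
  "(nat \<Rightarrow> real) \<Rightarrow> (nat \<Rightarrow> real) \<Rightarrow> nat \<Rightarrow> nat \<Rightarrow> real"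
  where "offspring_rate T lam j i = lam j * T (j - i)"

definition unit_arrival ::
  "(clock \<Rightarrow> real) \<Rightarrow> descent list \<Rightarrow> nat \<Rightarrow> nat \<Rightarrow> real"
  where "unit_arrival \<omega> u i n = (\<Sum>m\<le>n. \<omega> (Gap u i m))"

text \<open>The arrivals of a Poisson process of rate \<open>r\<close> are those of the unit rate process
  divided by \<open>r\<close>. The condition that an arrival precedes the termination of the branch is
  written without this division (see \<open>offspring_indices\<close>), so that there are almost surely
  no births at rate 0.\<close>

definition birth_time ::
  "(nat \<Rightarrow> real) \<Rightarrow> (nat \<Rightarrow> real) \<Rightarrow> (clock \<Rightarrow> real) \<Rightarrow> nat \<Rightarrow> descent list \<Rightarrow> nat \<times> nat \<Rightarrow> real"
  where "birth_time T lam \<omega> j u = (\<lambda>(i, n). unit_arrival \<omega> u i n / offspring_rate T lam j i)"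

definition offspring_indices ::
  "(nat \<Rightarrow> real) \<Rightarrow> (nat \<Rightarrow> real) \<Rightarrow> (clock \<Rightarrow> real) \<Rightarrow> nat \<Rightarrow> descent list \<Rightarrow> nat \<Rightarrow> nat set"
  where "offspring_indices T lam \<omega> j u i =
    {n. unit_arrival \<omega> u i n < offspring_rate T lam j i * lifetime lam \<omega> j u}"

text \<open>The offspring of a branch in order of birth. Almost surely the index sets are finite and
  the birth times are distinct.\<close>

definition offspring ::
  "(nat \<Rightarrow> real) \<Rightarrow> (nat \<Rightarrow> real) \<Rightarrow> (clock \<Rightarrow> real) \<Rightarrow> nat \<Rightarrow> descent list \<Rightarrow> (nat \<times> nat) list"
  where "offspring T lam \<omega> j u =
    sort_key (birth_time T lam \<omega> j u)
      (concat (map (\<lambda>i. map (Pair i) (sorted_list_of_set (offspring_indices T lam \<omega> j u i)))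
        [1..<j]))"

lemma offspring_order_less [termination_simp]:
  "(i, n) \<in> set (offspring T lam \<omega> j u) \<Longrightarrow> i < j"
  by (auto simp: offspring_def)

text \<open>The part of a branch after age \<open>s\<close>, with side branches attached at the listed ages,
  age \<open>l\<close> at termination, and the tree \<open>e\<close> below the terminal vertex.\<close>

fun assemble ::
  "real \<Rightarrow> (real \<times> (real \<times> ltree)) list \<Rightarrow> real \<Rightarrow> ltree \<Rightarrow> real \<times> ltree"
where
  "assemble s [] l e = (l - s, e)"
| "assemble s ((t, b) # bs) l e = (t - s, LVertex {#b, assemble t bs l e#})"

text \<open>The tree grown from branch \<open>u\<close>, of order \<open>j\<close>, together with the length of its first edge.\<close>

fun branch_tree ::
  "(nat \<Rightarrow> real) \<Rightarrow> (nat \<Rightarrow> real) \<Rightarrow> (clock \<Rightarrow> real) \<Rightarrow> nat \<Rightarrow> descent list \<Rightarrow> real \<times> ltree"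
where
  "branch_tree T lam \<omega> j u =
     assemble 0
       (map (\<lambda>(i, n). (birth_time T lam \<omega> j u (i, n), branch_tree T lam \<omega> i (Side i n # u)))
         (offspring T lam \<omega> j u))
       (lifetime lam \<omega> j u)
       (if j \<ge> 2
        then LVertex {#branch_tree T lam \<omega> (j - 1) (Split False # u),
                       branch_tree T lam \<omega> (j - 1) (Split True # u)#}
        else LVertex {#})"

declare branch_tree.simps [simp del]

text \<open>Almost surely all edge lengths are positive.\<close>

definition hbp_tree ::
  "(nat \<Rightarrow> real) \<Rightarrow> (nat \<Rightarrow> real) \<Rightarrow> nat \<times> (clock \<Rightarrow> real) \<Rightarrow> ltree"
  where "hbp_tree T lam = (\<lambda>(K, \<omega>). LVertex {#branch_tree T lam \<omega> K []#})"

definition hbp_shape_measure ::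
  "(nat \<Rightarrow> real) \<Rightarrow> (nat \<Rightarrow> real) \<Rightarrow> (nat \<Rightarrow> real) \<Rightarrow> rtree measure"
  where "hbp_shape_measure T lam p =
    distr (hbp_space p) (count_space UNIV) (\<lambda>x. tree_shape (hbp_tree T lam x))"

definition tokunaga_rate :: "real \<Rightarrow> real \<Rightarrow> nat \<Rightarrow> real"
  where "tokunaga_rate c \<gamma> j = \<gamma> * c powi (2 - int j)"

definition tokunaga_root_prob :: "nat \<Rightarrow> real"
  where "tokunaga_root_prob K = 2 powi (- int K)"

definition tokunaga_coeff :: "real \<Rightarrow> nat \<Rightarrow> real"
  where "tokunaga_coeff c k = (c - 1) * c ^ (k - 1)"

definition tokunaga_measure :: "real \<Rightarrow> real \<Rightarrow> rtree measure"
  where "tokunaga_measure c \<gamma> =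
    hbp_shape_measure (tokunaga_coeff c) (tokunaga_rate c \<gamma>) tokunaga_root_prob"

text \<open>\<open>uniform_measure M A\<close> is the measure \<open>M\<close> conditioned on \<open>A\<close>.\<close>

definition tokunaga_measure_order :: "real \<Rightarrow> real \<Rightarrow> nat \<Rightarrow> rtree measure"
  where "tokunaga_measure_order c \<gamma> K =
    uniform_measure (tokunaga_measure c \<gamma>) (trees_of_order K)"

definition mean_vertices :: "real \<Rightarrow> real \<Rightarrow> nat \<Rightarrow> nat \<Rightarrow> real"
  where "mean_vertices c \<gamma> k K =
    (\<integral>t. real (num_vertices k t) \<partial>tokunaga_measure_order c \<gamma> K)"

definition random_vertex :: "real \<Rightarrow> real \<Rightarrow> nat \<Rightarrow> rtree measure"
  where "random_vertex c \<gamma> K =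
    tokunaga_measure_order c \<gamma> K \<bind> (\<lambda>t. measure_pmf (pmf_of_multiset (nonroot_vertices t)))"

end

theory Submission
  imports Defs
begin

text \<open>
  Every vertex on a branch has the order of that branch. Hence the vertex counts of a random tree,
  and all other functionals \<open>order_sum\<close> that add up a weight of the order over the vertices, depend on the
  process only through the numbers of offspring and satisfy a distributional recursion
  (\<open>order_sum_branch_shape\<close>): a weight per vertex of the root branch, plus the independent values for
  its side branches and for the two branches into which it splits.

  A branch of order \<open>j\<close> has on average \<open>T\<^sub>j\<^sub>-\<^sub>i = (c - 1) c\<^sup>j\<^sup>-\<^sup>i\<^sup>-\<^sup>1\<close> side branches of order \<open>i\<close>, in fact a geometric
  number (\<open>offspring_count_moments\<close>). Solving the recursion for the means gives the expected number
  \<open>mean_count c k K\<close> of vertices of order \<open>k\<close> in a tree of order \<open>K\<close>, which is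
  \<open>c ^ (k - 1) * (A * (2 * c) ^ (K - k) + B)\<close> with constants \<open>A > 0\<close> and \<open>B\<close>.
  The ratio of the values for \<open>k\<close> and for 1 tends to \<open>2 powi (1 - k)\<close> (\<open>mean_ratio_limit\<close>).

  For the random vertex the expectation of the quotient \<open>V\<^sub>k / (2 * V\<^sub>1 - 1)\<close> is needed, as a binary
  tree with \<open>V\<^sub>1\<close> leaves has \<open>2 * V\<^sub>1 - 1\<close> non-root vertices. Consider the imbalance
  \<open>D = V\<^sub>k - 2 powi (1 - k) * V\<^sub>1\<close>. It is again an additive functional, and its mean is bounded, because
  the growing parts of the two means cancel. The variance recursion
  (\<open>moments_le_branch\<close>, \<open>tok_contraction\<close>) then bounds the second moment of \<open>D\<close> by a multiple of
  \<open>(3 * c\<^sup>2) ^ K\<close> (\<open>moments_le_imbalance\<close>), while \<open>V\<^sub>1\<close> is of the size \<open>(2 * c) ^ K\<close>. So \<open>D / V\<^sub>1\<close> tends to 0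
  unless \<open>V\<^sub>1\<close> is exceptionally small. That this has small probability follows from the self-similar
  structure: a tree of order \<open>K\<close> contains \<open>2 ^ m\<close> independent trees of order \<open>K - m\<close>, each of which has at least
  a small multiple of \<open>(2 * c) ^ (K - m)\<close> leaves with a probability bounded away from 0
  (\<open>leaves_lower_tail\<close>). As the fraction of vertices of order \<open>k\<close> lies between 0 and 1, its convergence
  in probability to \<open>2 powi (- k)\<close> gives convergence of its mean
  (\<open>expectation_order_fraction_limit\<close>).

  All moment bounds are proved by induction on the order, simultaneously for all branches of the
  family tree. This avoids comparing the distributions of subtrees grown at different places.
\<close>

section \<open>Horton-Strahler orders and additive functionals\<close>

text \<open>The recursive form of the Horton-Strahler order. The tree \<open>t\<close> hangs below its
  parental edge, so \<open>strahler t j\<close> speaks of the order of the planted tree \<open>Vertex {#t#}\<close>.\<close>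

inductive strahler :: "rtree \<Rightarrow> nat \<Rightarrow> bool" where
  leaf: "strahler (Vertex {#}) 1"
| fork: "strahler a i \<Longrightarrow> strahler b j \<Longrightarrow>
    strahler (Vertex {#a, b#}) (if i = j then Suc i else max i j)"

lemma strahler_binary_below: "strahler t j \<Longrightarrow> binary_below t"
  by (induction rule: strahler.induct) (auto intro: binary_below.intros)

lemma strahler_pos: "strahler t j \<Longrightarrow> j \<ge> 1"
  by (induction rule: strahler.induct) auto

lemma strahler_1: "strahler t j \<Longrightarrow> j = 1 \<longleftrightarrow> t = Vertex {#}"
  by (induction rule: strahler.induct) (auto dest: strahler_pos)

text \<open>Cutting the leaves below a fork leaves zero, one or two of its branches. With one branch
  left the fork has degree two, disappears in the series reduction and passes on the order of
  the larger subtree; with none left it becomes a leaf itself. In each case the order drops by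
  exactly one.\<close>

lemma strahler_reduce:
  assumes "strahler t j" "t \<noteq> Vertex {#}"
  shows "strahler (reduce_below (cut_leaves t)) (j - 1)"
  using assms
proof (induction rule: strahler.induct)
  case leaf
  then show ?case by simp
next
  case (fork a i b j)
  note pos = strahler_pos[OF fork(1)] strahler_pos[OF fork(2)]
  note one = strahler_1[OF fork(1)] strahler_1[OF fork(2)]
  consider "i = 1" "j = 1" | "i = 1" "j \<noteq> 1" | "i \<noteq> 1" "j = 1" | "i \<noteq> 1" "j \<noteq> 1" by blast
  then show ?case
  proof cases
    case 1
    then show ?thesis using one strahler.leaf by simp
  next
    case 2
    then show ?thesis using one pos fork(4) by (simp add: max_def)
  next
    case 3
    then show ?thesis using one pos fork(3) by (simp add: max_def)
  next
    case 4
    have "strahler (Vertex {#reduce_below (cut_leaves a), reduce_below (cut_leaves b)#})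
        (if i - 1 = j - 1 then Suc (i - 1) else max (i - 1) (j - 1))"
      using 4 one fork(3,4) by (intro strahler.fork) auto
    then show ?thesis using 4 one pos by (auto simp: max_def split: if_splits)
  qed
qed

lemma prune_strahler:
  assumes "strahler t j" "t \<noteq> Vertex {#}"
  shows "prune (Vertex {#t#}) = Vertex {#reduce_below (cut_leaves t)#}"
  using assms by (simp add: prune_def)

lemma strahler_prune_iterate:
  "strahler t j \<Longrightarrow> (prune ^^ k) (Vertex {#t#}) = empty_tree \<longleftrightarrow> j \<le> k"
proof (induction k arbitrary: t j)
  case 0
  then show ?case using strahler_pos[of t j] by (auto simp: empty_tree_def)
next
  case (Suc k)
  show ?case
  proof (cases "t = Vertex {#}")
    case True
    have e: "(prune ^^ k) empty_tree = empty_tree" for k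
      by (induction k) (auto simp: prune_def empty_tree_def)
    have "prune (Vertex {#t#}) = empty_tree"
      using True by (simp add: prune_def empty_tree_def)
    moreover have "j = 1" using True strahler_1[OF Suc.prems] by simp
    ultimately show ?thesis using e by (simp add: funpow_Suc_right del: funpow.simps)
  next
    case False
    then have "j \<noteq> 1" using strahler_1[OF Suc.prems] by simp
    then show ?thesis
      using Suc.IH[OF strahler_reduce[OF Suc.prems False]] prune_strahler[OF Suc.prems False]
        strahler_pos[OF Suc.prems]
      by (auto simp add: funpow_Suc_right simp del: funpow.simps)
  qed
qed

lemma vertex_order_strahler:
  assumes "strahler t j"
  shows "vertex_order t = j"
  unfolding vertex_order_def hs_order_def
  by (rule Least_equality) (auto simp: strahler_prune_iterate[OF assms])

text \<open>An additive functional of a tree: each vertex contributes a weight depending on its order.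
  Vertex counts and their linear combinations are of this form.\<close>

definition order_sum :: "(nat \<Rightarrow> real) \<Rightarrow> rtree \<Rightarrow> real"
  where "order_sum w t = (\<Sum>v\<in>#nonroot_vertices (Vertex {#t#}). w (vertex_order v))"

lemma order_sum_leaf: "order_sum w (Vertex {#}) = w 1"
  using vertex_order_strahler[OF strahler.leaf] by (simp add: order_sum_def)

lemma order_sum_fork:
  assumes "strahler (Vertex {#a, b#}) j"
  shows "order_sum w (Vertex {#a, b#}) = w j + order_sum w a + order_sum w b"
  using vertex_order_strahler[OF assms] by (simp add: order_sum_def)

text \<open>A single branch with the trees \<open>ts\<close> attached along it, above the tree \<open>e\<close> in which it
  terminates.\<close>

definition spine :: "rtree list \<Rightarrow> rtree \<Rightarrow> rtree"
  where "spine ts e = foldr (\<lambda>a t. Vertex {#a, t#}) ts e"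

lemma spine_simps [simp]: "spine [] e = e" "spine (a # ts) e = Vertex {#a, spine ts e#}"
  by (simp_all add: spine_def)

text \<open>A side branch of smaller order does not change the order when it merges, so the order is
  constant along a branch.\<close>

lemma strahler_spine:
  assumes "strahler e j" "\<And>a. a \<in> set ts \<Longrightarrow> \<exists>i<j. strahler a i"
  shows "strahler (spine ts e) j"
  using assms(2)
proof (induction ts)
  case Nil
  then show ?case using assms by simp
next
  case (Cons a ts)
  then obtain i where "i < j" "strahler a i" by auto
  with strahler.fork[OF this(2) Cons.IH] Cons.prems show ?case by (auto simp: max_def)
qed

lemma order_sum_spine:
  assumes "strahler e j" "\<And>a. a \<in> set ts \<Longrightarrow> \<exists>i<j. strahler a i"
  shows "order_sum w (spine ts e) = (\<Sum>a\<leftarrow>ts. w j + order_sum w a) + order_sum w e"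
  using assms(2)
proof (induction ts)
  case Nil
  then show ?case by simp
next
  case (Cons a ts)
  have "strahler (spine (a # ts) e) j"
    by (rule strahler_spine[OF assms(1) Cons.prems])
  from order_sum_fork[OF this[unfolded spine_simps]] Cons show ?case by simp
qed

section \<open>The shape of a branch\<close>

definition branch_shape ::
  "(nat \<Rightarrow> real) \<Rightarrow> (nat \<Rightarrow> real) \<Rightarrow> (clock \<Rightarrow> real) \<Rightarrow> nat \<Rightarrow> descent list \<Rightarrow> rtree"
  where "branch_shape T lam \<omega> j u = tree_shape (snd (branch_tree T lam \<omega> j u))"

lemma tree_shape_assemble:
  "tree_shape (snd (assemble s bs l e)) = spine (map (\<lambda>b. tree_shape (snd (snd b))) bs) (tree_shape e)"
  by (induction s bs l e rule: assemble.induct) auto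

text \<open>Forgetting the edge lengths leaves a recursion that sees the clocks only through the list of
  offspring.\<close>

lemma branch_shape_rec:
  "branch_shape T lam \<omega> j u =
     spine (map (\<lambda>(i, n). branch_shape T lam \<omega> i (Side i n # u)) (offspring T lam \<omega> j u))
       (if j \<ge> 2
        then Vertex {#branch_shape T lam \<omega> (j - 1) (Split False # u),
                      branch_shape T lam \<omega> (j - 1) (Split True # u)#}
        else Vertex {#})"
  unfolding branch_shape_def
  by (subst branch_tree.simps)
    (simp add: tree_shape_assemble comp_def split_def)

lemma offspring_order_ge_1: "(i, n) \<in> set (offspring T lam \<omega> j u) \<Longrightarrow> i \<ge> 1"
  by (auto simp: offspring_def)

lemma strahler_branch_end:
  assumes "j \<ge> 1" "j \<ge> 2 \<Longrightarrow> strahler a (j - 1)" "j \<ge> 2 \<Longrightarrow> strahler b (j - 1)"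
  shows "strahler (if j \<ge> 2 then Vertex {#a, b#} else Vertex {#}) j"
proof (cases "j \<ge> 2")
  case True
  then show ?thesis
    using strahler.fork[OF assms(2) assms(3)] by simp
next
  case False
  then have "j = 1" using assms(1) by simp
  then show ?thesis using strahler.leaf by simp
qed

lemma strahler_branch_shape:
  "j \<ge> 1 \<Longrightarrow> strahler (branch_shape T lam \<omega> j u) j"
proof (induction j arbitrary: u rule: less_induct)
  case (less j)
  show ?case
    unfolding branch_shape_rec[of T lam \<omega> j u]
  proof (rule strahler_spine, goal_cases)
    case 1
    show ?case
      by (rule strahler_branch_end) (use less in auto)
  next
    case (2 a)
    then obtain i n where "(i, n) \<in> set (offspring T lam \<omega> j u)"
      and a: "a = branch_shape T lam \<omega> i (Side i n # u)" by auto
    then have "i < j" "i \<ge> 1" using offspring_order_less offspring_order_ge_1 by blast+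
    then show ?case using less.IH a by blast
  qed
qed

text \<open>All vertices on a branch have the order of the branch, so an additive functional does not
  depend on the order in which the side branches were born: only their number for each order
  matters.\<close>

lemma order_sum_branch_shape:
  assumes "j \<ge> 1"
  shows "order_sum w (branch_shape T lam \<omega> j u) =
    w j + (\<Sum>(i, n)\<leftarrow>offspring T lam \<omega> j u. w j + order_sum w (branch_shape T lam \<omega> i (Side i n # u)))
    + (if j \<ge> 2 then order_sum w (branch_shape T lam \<omega> (j - 1) (Split False # u))
                  + order_sum w (branch_shape T lam \<omega> (j - 1) (Split True # u)) else 0)"
proof -
  let ?a = "branch_shape T lam \<omega> (j - 1) (Split False # u)"
  let ?b = "branch_shape T lam \<omega> (j - 1) (Split True # u)"
  let ?e = "if j \<ge> 2 then Vertex {#?a, ?b#} else Vertex {#}"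
  let ?ts = "map (\<lambda>(i, n). branch_shape T lam \<omega> i (Side i n # u)) (offspring T lam \<omega> j u)"
  have e: "strahler ?e j"
    by (rule strahler_branch_end) (use assms strahler_branch_shape in auto)
  have ts: "\<exists>i<j. strahler a i" if "a \<in> set ?ts" for a
  proof -
    from that obtain i n where "(i, n) \<in> set (offspring T lam \<omega> j u)"
      and a: "a = branch_shape T lam \<omega> i (Side i n # u)" by auto
    then have "i < j" "i \<ge> 1" using offspring_order_less offspring_order_ge_1 by blast+
    then show ?thesis using strahler_branch_shape a by blast
  qed
  have "order_sum w ?e = w j + (if j \<ge> 2 then order_sum w ?a + order_sum w ?b else 0)"
  proof (cases "j \<ge> 2")
    case True
    then have "strahler (Vertex {#?a, ?b#}) j" using e by simp
    then show ?thesis using order_sum_fork[of ?a ?b j] True by simp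
  next
    case False
    then have "j = 1" using assms by simp
    then show ?thesis by (simp add: order_sum_leaf)
  qed
  moreover have "order_sum w (spine ?ts ?e) = (\<Sum>a\<leftarrow>?ts. w j + order_sum w a) + order_sum w ?e"
    by (rule order_sum_spine[OF e ts])
  ultimately show ?thesis
    by (subst branch_shape_rec) (simp add: comp_def split_def)
qed

section \<open>Measurability of the random tree\<close>

text \<open>Trees with ordered children. Since every finite tree can be drawn in the plane, the
  countability of this datatype carries over to \<open>rtree\<close>; events about random trees then split into
  countably many cases.\<close>

datatype planar = Planar "planar list"

instance planar :: countable
  by countable_datatype

primrec forget_order :: "planar \<Rightarrow> rtree" where
  "forget_order (Planar ts) = Vertex (mset (map forget_order ts))"

lemma surj_forget_order: "surj forget_order"
proof -
  have "t \<in> range forget_order" for t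
  proof (induction t)
    case (Vertex M)
    obtain ts where M: "M = mset ts" using ex_mset by metis
    have "\<exists>ps. ts = map forget_order ps"
      unfolding ex_map_conv using Vertex M by fastforce
    then obtain ps where "ts = map forget_order ps" by blast
    then have "Vertex M = forget_order (Planar ps)" using M by simp
    then show ?case by blast
  qed
  then show ?thesis by blast
qed

instance rtree :: countable
proof
  have "countable (UNIV :: rtree set)"
    using surj_forget_order by (metis countableI_type countable_image)
  then show "\<exists>to_nat :: rtree \<Rightarrow> nat. inj to_nat"
    by (auto simp: countable_def)
qed

text \<open>An infinite set is sent to the empty list. Finiteness of a set of natural numbers means
  boundedness, so the distinction of the two cases is a countable combination of membership events.\<close>

lemma measurable_sorted_list_of_set:
  assumes S: "\<And>n. {x \<in> space N. n \<in> S x} \<in> sets N"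
  shows "(\<lambda>x. sorted_list_of_set (S x :: nat set)) \<in> N \<rightarrow>\<^sub>M count_space UNIV"
proof -
  have [measurable]: "Measurable.pred N (\<lambda>x. n \<in> S x)" for n
    using S by (simp add: pred_def)
  have eq: "sorted_list_of_set A = xs \<longleftrightarrow>
      (if \<exists>m. \<forall>n. n \<ge> m \<longrightarrow> n \<notin> A then sorted xs \<and> distinct xs \<and> (\<forall>n. n \<in> A \<longleftrightarrow> n \<in> set xs) else xs = [])"
    for A :: "nat set" and xs
  proof -
    have "finite A \<longleftrightarrow> (\<exists>m. \<forall>n. n \<ge> m \<longrightarrow> n \<notin> A)"
      by (meson finite_nat_set_iff_bounded not_le)
    moreover have "sorted_list_of_set A = [] \<or> finite A"
      using sorted_list_of_set.fold_insort_key.infinite by blast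
    moreover have "finite A \<Longrightarrow> sorted_list_of_set A = xs \<longleftrightarrow> sorted xs \<and> distinct xs \<and> set xs = A"
      using sorted_list_of_set_unique by (metis set_sorted_list_of_set sorted_list_of_set.distinct_sorted_key_list_of_set sorted_list_of_set.idem_if_sorted_distinct sorted_sorted_list_of_set)
    ultimately show ?thesis by auto
  qed
  have "Measurable.pred N (\<lambda>x. sorted_list_of_set (S x) = xs)" for xs
    unfolding eq by measurable
  then have "(\<lambda>x. sorted_list_of_set (S x)) -` {xs} \<inter> space N \<in> sets N" for xs
    by (simp add: pred_def vimage_def Int_def conj_commute)
  then show ?thesis
    by (simp add: measurable_count_space_eq2_countable)
qed

lemma measurable_insort_key:
  assumes f [measurable]: "\<And>y. (\<lambda>x. f x y) \<in> borel_measurable N"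
  shows "(\<lambda>x. insort_key (f x :: _ \<Rightarrow> real) (y :: 'a :: countable) ys) \<in> N \<rightarrow>\<^sub>M count_space UNIV"
proof (induction ys)
  case Nil
  then show ?case by simp
next
  case (Cons z ys)
  have "(\<lambda>x. z # insort_key (f x) y ys) \<in> N \<rightarrow>\<^sub>M count_space UNIV"
    by (rule measurable_compose[OF Cons]) simp
  moreover have "Measurable.pred N (\<lambda>x. f x y \<le> f x z)"
    by measurable
  ultimately show ?case
    unfolding insort_key.simps by (intro measurable_If) (auto simp: pred_def)
qed

lemma measurable_sort_key:
  assumes f: "\<And>y. (\<lambda>x. f x y) \<in> borel_measurable N"
  shows "(\<lambda>x. sort_key (f x :: _ \<Rightarrow> real) (ys :: 'a :: countable list)) \<in> N \<rightarrow>\<^sub>M count_space UNIV"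
proof (induction ys)
  case Nil
  then show ?case by simp
next
  case (Cons y ys)
  have "(\<lambda>x. insort_key (f x) y (sort_key (f x) ys)) \<in> N \<rightarrow>\<^sub>M count_space UNIV"
    by (rule measurable_compose_countable[OF measurable_insort_key[OF f] Cons])
  then show ?case by simp
qed

lemma measurable_concat_map:
  assumes "\<And>i. i \<in> set is \<Longrightarrow> f i \<in> N \<rightarrow>\<^sub>M count_space UNIV"
  shows "(\<lambda>x. concat (map (\<lambda>i. f i x) is) :: 'a :: countable list) \<in> N \<rightarrow>\<^sub>M count_space UNIV"
  using assms
proof (induction "is")
  case Nil
  then show ?case by simp
next
  case (Cons i "is")
  have 1: "f i \<in> N \<rightarrow>\<^sub>M count_space UNIV"
    and 2: "(\<lambda>x. concat (map (\<lambda>i. f i x) is)) \<in> N \<rightarrow>\<^sub>M count_space UNIV"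
    using Cons by auto
  have "(\<lambda>x. f i x @ concat (map (\<lambda>i. f i x) is)) \<in> N \<rightarrow>\<^sub>M count_space UNIV"
    by (rule measurable_compose_countable[OF measurable_compose[OF 2] 1]) simp
  then show ?case by simp
qed

lemma measurable_spine:
  assumes "\<And>i. i \<in> set is \<Longrightarrow> f i \<in> N \<rightarrow>\<^sub>M count_space UNIV" "e \<in> N \<rightarrow>\<^sub>M count_space UNIV"
  shows "(\<lambda>x. spine (map (\<lambda>i. f i x) is) (e x)) \<in> N \<rightarrow>\<^sub>M count_space UNIV"
  using assms
proof (induction "is")
  case Nil
  then show ?case by simp
next
  case (Cons i "is")
  have 1: "f i \<in> N \<rightarrow>\<^sub>M count_space UNIV"
    and 2: "(\<lambda>x. spine (map (\<lambda>i. f i x) is) (e x)) \<in> N \<rightarrow>\<^sub>M count_space UNIV"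
    using Cons by auto
  have "(\<lambda>x. Vertex {#f i x, spine (map (\<lambda>i. f i x) is) (e x)#}) \<in> N \<rightarrow>\<^sub>M count_space UNIV"
    by (rule measurable_compose_countable[OF measurable_compose[OF 2] 1]) simp
  then show ?case by simp
qed

lemma measurable_offspring:
  assumes [measurable]: "\<And>c. (\<lambda>x. X x c) \<in> borel_measurable N"
  shows "(\<lambda>x. offspring T lam (X x) j u) \<in> N \<rightarrow>\<^sub>M count_space UNIV"
proof -
  have [measurable]: "(\<lambda>x. birth_time T lam (X x) j u y) \<in> borel_measurable N" for y
    unfolding birth_time_def unit_arrival_def by (cases y) simp
  have "(\<lambda>x. sorted_list_of_set (offspring_indices T lam (X x) j u i)) \<in> N \<rightarrow>\<^sub>M count_space UNIV" for i
    unfolding offspring_indices_def unit_arrival_def lifetime_def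
    by (rule measurable_sorted_list_of_set) simp
  then have "(\<lambda>x. map (Pair i) (sorted_list_of_set (offspring_indices T lam (X x) j u i)))
      \<in> N \<rightarrow>\<^sub>M count_space UNIV" for i
    by (rule measurable_compose) simp
  then have "(\<lambda>x. concat (map (\<lambda>i. map (Pair i) (sorted_list_of_set (offspring_indices T lam (X x) j u i)))
        [1..<j])) \<in> N \<rightarrow>\<^sub>M count_space UNIV"
    by (intro measurable_concat_map)
  moreover have "(\<lambda>x. sort_key (birth_time T lam (X x) j u) ys) \<in> N \<rightarrow>\<^sub>M count_space UNIV" for ys
    by (rule measurable_sort_key) measurable
  ultimately show ?thesis
    unfolding offspring_def by (rule measurable_compose_countable[rotated])
qed

lemma measurable_branch_shape:
  assumes X: "\<And>c. (\<lambda>x. X x c) \<in> borel_measurable N"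
  shows "(\<lambda>x. branch_shape T lam (X x) j u) \<in> N \<rightarrow>\<^sub>M count_space UNIV"
proof (induction j arbitrary: u rule: less_induct)
  case (less j)
  have e: "(\<lambda>x. if j \<ge> 2
        then Vertex {#branch_shape T lam (X x) (j - 1) (Split False # u),
                      branch_shape T lam (X x) (j - 1) (Split True # u)#}
        else Vertex {#}) \<in> N \<rightarrow>\<^sub>M count_space UNIV" (is "?e \<in> _")
  proof (cases "j \<ge> 2")
    case True
    then have 1: "(\<lambda>x. branch_shape T lam (X x) (j - 1) (Split b # u)) \<in> N \<rightarrow>\<^sub>M count_space UNIV" for b
      by (intro less.IH) simp
    have "(\<lambda>x. Vertex {#branch_shape T lam (X x) (j - 1) (Split False # u),
                      branch_shape T lam (X x) (j - 1) (Split True # u)#}) \<in> N \<rightarrow>\<^sub>M count_space UNIV"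
      by (rule measurable_compose_countable[OF measurable_compose[OF 1] 1]) simp
    then show ?thesis using True by simp
  qed simp
  \<comment> \<open>The induction hypothesis covers only offspring of order below \<open>j\<close>. A fixed list \<open>L\<close> may
    contain others, and these are replaced by leaves.\<close>
  let ?sub = "\<lambda>(i, n) x. if i < j then branch_shape T lam (X x) i (Side i n # u) else Vertex {#}"
  have "?sub y \<in> N \<rightarrow>\<^sub>M count_space UNIV" for y
    using less.IH[of "fst y"] by (cases y; cases "fst y < j") simp_all
  then have "(\<lambda>x. spine (map (\<lambda>y. ?sub y x) L) (?e x)) \<in> N \<rightarrow>\<^sub>M count_space UNIV" for L
    by (intro measurable_spine[OF _ e])
  then have "(\<lambda>x. spine (map (\<lambda>y. ?sub y x) (offspring T lam (X x) j u)) (?e x)) \<in> N \<rightarrow>\<^sub>M count_space UNIV"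
    by (rule measurable_compose_countable[OF _ measurable_offspring[OF X]])
  also have "(\<lambda>x. spine (map (\<lambda>y. ?sub y x) (offspring T lam (X x) j u)) (?e x))
      = (\<lambda>x. branch_shape T lam (X x) j u)"
  proof
    fix x
    have m: "map (\<lambda>y. ?sub y x) (offspring T lam (X x) j u) =
      map (\<lambda>(i, n). branch_shape T lam (X x) i (Side i n # u)) (offspring T lam (X x) j u)"
      by (rule map_cong) (use offspring_order_less in auto)
    then show "spine (map (\<lambda>y. ?sub y x) (offspring T lam (X x) j u)) (?e x)
        = branch_shape T lam (X x) j u"
      unfolding branch_shape_rec[of T lam "X x" j u] m by simp
  qed
  finally show ?case .
qed

section \<open>Locality of the construction\<close>

primrec branch_of :: "clock \<Rightarrow> descent list" where
  "branch_of (Life u) = u"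
| "branch_of (Gap u i n) = u"

definition own_clocks :: "descent list \<Rightarrow> clock set"
  where "own_clocks u = {x. branch_of x = u}"

definition clocks_below :: "descent list \<Rightarrow> clock set"
  where "clocks_below u = {x. \<exists>v. branch_of x = v @ u}"

lemma offspring_cong:
  assumes "\<And>x. x \<in> own_clocks u \<Longrightarrow> \<omega> x = \<omega>' x"
  shows "offspring T lam \<omega> j u = offspring T lam \<omega>' j u"
proof -
  have "unit_arrival \<omega> u = unit_arrival \<omega>' u" "lifetime lam \<omega> j u = lifetime lam \<omega>' j u"
    using assms by (auto simp: unit_arrival_def lifetime_def own_clocks_def intro!: ext)
  then show ?thesis
    by (simp add: offspring_def offspring_indices_def birth_time_def)
qed

text \<open>The subtree of a branch is a function of the clocks of the branch and its descendants. As
  the sets of clocks of different children are disjoint, this gives independence of their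
  subtrees.\<close>

lemma branch_shape_cong:
  assumes "\<And>x. x \<in> clocks_below u \<Longrightarrow> \<omega> x = \<omega>' x"
  shows "branch_shape T lam \<omega> j u = branch_shape T lam \<omega>' j u"
  using assms
proof (induction j arbitrary: u rule: less_induct)
  case (less j)
  have sub: "branch_shape T lam \<omega> i (d # u) = branch_shape T lam \<omega>' i (d # u)" if "i < j" for i d
  proof (rule less.IH[OF that])
    fix x assume "x \<in> clocks_below (d # u)"
    then obtain v where "branch_of x = v @ d # u" by (auto simp: clocks_below_def)
    then have "branch_of x = (v @ [d]) @ u" by simp
    then have "x \<in> clocks_below u" unfolding clocks_below_def by blast
    then show "\<omega> x = \<omega>' x" by (rule less.prems)
  qed
  have off: "offspring T lam \<omega> j u = offspring T lam \<omega>' j u"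
    by (rule offspring_cong) (auto intro!: less.prems simp: own_clocks_def clocks_below_def)
  have "map (\<lambda>(i, n). branch_shape T lam \<omega> i (Side i n # u)) (offspring T lam \<omega> j u) =
      map (\<lambda>(i, n). branch_shape T lam \<omega>' i (Side i n # u)) (offspring T lam \<omega>' j u)"
    unfolding off using sub offspring_order_less by (intro map_cong) auto
  moreover have "j \<ge> 2 \<Longrightarrow> branch_shape T lam \<omega> (j - 1) (Split b # u) =
      branch_shape T lam \<omega>' (j - 1) (Split b # u)" for b
    by (rule sub) simp
  ultimately show ?case
    unfolding branch_shape_rec[of T lam \<omega> j u] branch_shape_rec[of T lam \<omega>' j u] by simp
qed

lemma own_clocks_disjoint: "own_clocks u \<inter> clocks_below (d # u) = {}"
proof -
  have "v @ d # u \<noteq> u" for v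
    by (metis append_Cons append_Nil append_assoc append_self_conv2 list.distinct(1))
  then show ?thesis by (auto simp: own_clocks_def clocks_below_def)
qed

lemma clocks_below_disjoint: "d \<noteq> d' \<Longrightarrow> clocks_below (d # u) \<inter> clocks_below (d' # u) = {}"
  by (auto simp: clocks_below_def)

section \<open>Moments of random sums\<close>

text \<open>The mean is recorded exactly, since it is needed for centring, while for the variance an
  upper bound is enough.\<close>

definition (in prob_space) moments_le :: "('a \<Rightarrow> real) \<Rightarrow> real \<Rightarrow> real \<Rightarrow> bool"
  where "moments_le X m v \<longleftrightarrow> integrable M X \<and> expectation X = m \<and>
    integrable M (\<lambda>\<omega>. (X \<omega> - m)\<^sup>2) \<and> expectation (\<lambda>\<omega>. (X \<omega> - m)\<^sup>2) \<le> v"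

lemma (in prob_space) moments_le_indep_add:
  assumes ind: "indep_var borel X borel Y" and X: "moments_le X m v" and Y: "moments_le Y m' v'"
  shows "moments_le (\<lambda>\<omega>. X \<omega> + Y \<omega>) (m + m') (v + v')"
proof -
  have iX: "integrable M X" and iY: "integrable M Y"
    and mX: "expectation X = m" and mY: "expectation Y = m'"
    using X Y by (auto simp: moments_le_def)
  have ind': "indep_var borel (\<lambda>\<omega>. X \<omega> - m) borel (\<lambda>\<omega>. Y \<omega> - m')"
    using indep_var_compose[OF ind, of "\<lambda>x. x - m" borel "\<lambda>x. x - m'" borel] by (simp add: comp_def)
  have "integrable M (\<lambda>\<omega>. (X \<omega> - m) * (Y \<omega> - m'))"
    by (rule indep_var_integrable[OF ind']) (use iX iY in auto)
  moreover have "expectation (\<lambda>\<omega>. (X \<omega> - m) * (Y \<omega> - m')) = 0"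
    by (subst indep_var_lebesgue_integral[OF ind']) (use iX iY mX mY prob_space in auto)
  moreover have "(X \<omega> + Y \<omega> - (m + m'))\<^sup>2 =
      (X \<omega> - m)\<^sup>2 + (Y \<omega> - m')\<^sup>2 + 2 * ((X \<omega> - m) * (Y \<omega> - m'))" for \<omega>
    by (simp add: power2_eq_square algebra_simps)
  ultimately show ?thesis
    using X Y by (simp add: moments_le_def)
qed

lemma (in prob_space) moments_le_indep_sum:
  assumes "finite D" "indep_vars (\<lambda>_. borel) Y D" "\<And>d. d \<in> D \<Longrightarrow> moments_le (Y d) (m d) (v d)"
  shows "moments_le (\<lambda>\<omega>. \<Sum>d\<in>D. Y d \<omega>) (\<Sum>d\<in>D. m d) (\<Sum>d\<in>D. v d)"
  using assms
proof (induction D rule: finite_induct)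
  case empty
  then show ?case by (simp add: moments_le_def)
next
  case (insert d D)
  have "indep_vars (\<lambda>_. borel) Y D"
    by (rule indep_vars_subset[OF insert.prems(1)]) auto
  then have "moments_le (\<lambda>\<omega>. \<Sum>d\<in>D. Y d \<omega>) (\<Sum>d\<in>D. m d) (\<Sum>d\<in>D. v d)"
    using insert by auto
  from moments_le_indep_add[OF indep_vars_sum[OF insert.hyps insert.prems(1)] insert.prems(2) this]
  show ?case using insert.hyps by simp
qed

lemma (in prob_space) moments_le_second_moment:
  assumes "moments_le X m v"
  shows "integrable M (\<lambda>\<omega>. (a + (X \<omega> - m))\<^sup>2)"
    and "expectation (\<lambda>\<omega>. (a + (X \<omega> - m))\<^sup>2) \<le> a\<^sup>2 + v"
proof -
  have *: "(a + (X \<omega> - m))\<^sup>2 = a\<^sup>2 + 2 * a * (X \<omega> - m) + (X \<omega> - m)\<^sup>2" for \<omega>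
    by (simp add: power2_eq_square algebra_simps)
  show "integrable M (\<lambda>\<omega>. (a + (X \<omega> - m))\<^sup>2)"
    unfolding * using assms by (simp add: moments_le_def)
  have "expectation (\<lambda>\<omega>. X \<omega> - m) = 0"
    using assms prob_space by (simp add: moments_le_def)
  then show "expectation (\<lambda>\<omega>. (a + (X \<omega> - m))\<^sup>2) \<le> a\<^sup>2 + v"
    unfolding * using assms prob_space by (simp add: moments_le_def)
qed

text \<open>Independence of two random variables whose values lie in different types, stated as the
  factorization of the joint distribution.\<close>

definition (in prob_space) indep_pair ::
  "'b measure \<Rightarrow> ('a \<Rightarrow> 'b) \<Rightarrow> 'c measure \<Rightarrow> ('a \<Rightarrow> 'c) \<Rightarrow> bool"
  where "indep_pair S X N Y \<longleftrightarrow> X \<in> M \<rightarrow>\<^sub>M S \<and> Y \<in> M \<rightarrow>\<^sub>M N \<and>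
    distr M (S \<Otimes>\<^sub>M N) (\<lambda>\<omega>. (X \<omega>, Y \<omega>)) = distr M S X \<Otimes>\<^sub>M distr M N Y"

lemma (in prob_space) indep_pair_compose:
  assumes ind: "indep_var S X N Y" and f [measurable]: "f \<in> S \<rightarrow>\<^sub>M S'" and g [measurable]: "g \<in> N \<rightarrow>\<^sub>M N'"
  shows "indep_pair S' (\<lambda>\<omega>. f (X \<omega>)) N' (\<lambda>\<omega>. g (Y \<omega>))"
proof -
  have X [measurable]: "X \<in> M \<rightarrow>\<^sub>M S" and Y [measurable]: "Y \<in> M \<rightarrow>\<^sub>M N"
    and eq: "distr M (S \<Otimes>\<^sub>M N) (\<lambda>x. (X x, Y x)) = distr M S X \<Otimes>\<^sub>M distr M N Y"
    using ind unfolding indep_var_distribution_eq by auto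
  interpret Y': prob_space "distr (distr M N Y) N' g"
    by (intro prob_space.prob_space_distr prob_space_distr) auto
  have "distr M S' (\<lambda>\<omega>. f (X \<omega>)) \<Otimes>\<^sub>M distr M N' (\<lambda>\<omega>. g (Y \<omega>)) =
      distr (distr M S X) S' f \<Otimes>\<^sub>M distr (distr M N Y) N' g"
    by (simp add: distr_distr comp_def)
  also have "\<dots> = distr (distr M S X \<Otimes>\<^sub>M distr M N Y) (S' \<Otimes>\<^sub>M N') (\<lambda>(x, y). (f x, g y))"
    by (rule pair_measure_distr) (auto intro: Y'.sigma_finite_measure_axioms)
  also have "\<dots> = distr M (S' \<Otimes>\<^sub>M N') (\<lambda>\<omega>. (f (X \<omega>), g (Y \<omega>)))"
    unfolding eq[symmetric] by (simp add: distr_distr comp_def)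
  finally show ?thesis by (simp add: indep_pair_def)
qed

lemma (in prob_space) indep_pair_compose2:
  assumes "indep_pair S X N Y" and g [measurable]: "g \<in> N \<rightarrow>\<^sub>M N'"
  shows "indep_pair S X N' (\<lambda>\<omega>. g (Y \<omega>))"
proof -
  have X [measurable]: "X \<in> M \<rightarrow>\<^sub>M S" and Y [measurable]: "Y \<in> M \<rightarrow>\<^sub>M N"
    and eq: "distr M (S \<Otimes>\<^sub>M N) (\<lambda>x. (X x, Y x)) = distr M S X \<Otimes>\<^sub>M distr M N Y"
    using assms unfolding indep_pair_def by auto
  interpret Y': prob_space "distr (distr M N Y) N' g"
    by (intro prob_space.prob_space_distr prob_space_distr) auto
  have "distr M S X \<Otimes>\<^sub>M distr M N' (\<lambda>\<omega>. g (Y \<omega>)) =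
      distr (distr M S X) S (\<lambda>x. x) \<Otimes>\<^sub>M distr (distr M N Y) N' g"
    by (simp add: distr_distr comp_def)
  also have "\<dots> = distr (distr M S X \<Otimes>\<^sub>M distr M N Y) (S \<Otimes>\<^sub>M N') (\<lambda>(x, y). (x, g y))"
    by (rule pair_measure_distr) (auto intro: Y'.sigma_finite_measure_axioms)
  also have "\<dots> = distr M (S \<Otimes>\<^sub>M N') (\<lambda>\<omega>. (X \<omega>, g (Y \<omega>)))"
    unfolding eq[symmetric] by (simp add: distr_distr comp_def)
  finally show ?thesis by (simp add: indep_pair_def)
qed

text \<open>Fubini's theorem for an independent pair: the second component may be replaced by a fresh
  copy. Countability of the first component reduces joint measurability to measurability in the
  second.\<close>

lemma (in prob_space) indep_pair_decouple:
  fixes L :: "'a \<Rightarrow> 'l :: countable"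
  assumes ind: "indep_pair (count_space UNIV) L N Y"
  shows indep_pair_decouple_nn: "(\<And>l. g l \<in> borel_measurable N) \<Longrightarrow>
      (\<integral>\<^sup>+\<omega>. g (L \<omega>) (Y \<omega>) \<partial>M) = (\<integral>\<^sup>+\<omega>. \<integral>\<^sup>+\<omega>'. g (L \<omega>) (Y \<omega>') \<partial>M \<partial>M)"
    and indep_pair_decouple_integral: "(\<And>l. h l \<in> borel_measurable N) \<Longrightarrow>
      integrable M (\<lambda>\<omega>. h (L \<omega>) (Y \<omega>)) \<Longrightarrow>
      expectation (\<lambda>\<omega>. h (L \<omega>) (Y \<omega>)) = expectation (\<lambda>\<omega>. expectation (\<lambda>\<omega>'. (h (L \<omega>) (Y \<omega>') :: real)))"
proof -
  let ?L = "distr M (count_space UNIV) L" and ?Y = "distr M N Y"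
  have L [measurable]: "L \<in> M \<rightarrow>\<^sub>M count_space UNIV" and Y [measurable]: "Y \<in> M \<rightarrow>\<^sub>M N"
    and eq: "distr M (count_space UNIV \<Otimes>\<^sub>M N) (\<lambda>x. (L x, Y x)) = ?L \<Otimes>\<^sub>M ?Y"
    using ind unfolding indep_pair_def by auto
  interpret L: prob_space ?L by (rule prob_space_distr) simp
  interpret Y: prob_space ?Y by (rule prob_space_distr) simp
  interpret P: pair_prob_space ?L ?Y ..
  {
    assume [measurable]: "\<And>l. g l \<in> borel_measurable N"
    have [measurable]: "case_prod g \<in> borel_measurable (count_space UNIV \<Otimes>\<^sub>M N)"
      by (rule measurable_pair_measure_countable1) auto
    have "(\<integral>\<^sup>+\<omega>. g (L \<omega>) (Y \<omega>) \<partial>M) = (\<integral>\<^sup>+z. case_prod g z \<partial>(?L \<Otimes>\<^sub>M ?Y))"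
      unfolding eq[symmetric] by (subst nn_integral_distr) auto
    also have "\<dots> = (\<integral>\<^sup>+l. \<integral>\<^sup>+y. g l y \<partial>?Y \<partial>?L)"
      by (subst Y.nn_integral_fst[symmetric]) auto
    also have "\<dots> = (\<integral>\<^sup>+\<omega>. \<integral>\<^sup>+\<omega>'. g (L \<omega>) (Y \<omega>') \<partial>M \<partial>M)"
      by (simp add: nn_integral_distr)
    finally show "(\<integral>\<^sup>+\<omega>. g (L \<omega>) (Y \<omega>) \<partial>M) = (\<integral>\<^sup>+\<omega>. \<integral>\<^sup>+\<omega>'. g (L \<omega>) (Y \<omega>') \<partial>M \<partial>M)" .
  }
  {
    assume [measurable]: "\<And>l. h l \<in> borel_measurable N"
      and int: "integrable M (\<lambda>\<omega>. h (L \<omega>) (Y \<omega>))"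
    have [measurable]: "case_prod h \<in> borel_measurable (count_space UNIV \<Otimes>\<^sub>M N)"
      by (rule measurable_pair_measure_countable1) auto
    have i: "integrable (?L \<Otimes>\<^sub>M ?Y) (case_prod h)"
      unfolding eq[symmetric] using int by (subst integrable_distr_eq) auto
    have "expectation (\<lambda>\<omega>. h (L \<omega>) (Y \<omega>)) = (\<integral>z. case_prod h z \<partial>(?L \<Otimes>\<^sub>M ?Y))"
      unfolding eq[symmetric] by (subst integral_distr) auto
    also have "\<dots> = (\<integral>l. \<integral>y. h l y \<partial>?Y \<partial>?L)"
      by (subst P.integral_fst'[OF i, symmetric]) auto
    also have "\<dots> = expectation (\<lambda>\<omega>. expectation (\<lambda>\<omega>'. (h (L \<omega>) (Y \<omega>') :: real)))"
      by (simp add: integral_distr)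
    finally show "expectation (\<lambda>\<omega>. h (L \<omega>) (Y \<omega>)) =
        expectation (\<lambda>\<omega>. expectation (\<lambda>\<omega>'. (h (L \<omega>) (Y \<omega>') :: real)))" .
  }
qed

text \<open>The second moment of a random sum, as in Wald's identities. The sum splits into
  \<open>a (L \<omega>) + (\<Sum>d\<in>D (L \<omega>). m d)\<close>, a function of \<open>L\<close> alone with variance at most \<open>s\<close>, and the centred
  remainder. Given \<open>L\<close> the remainder is a finite sum of independent centred variables, so it is
  orthogonal to the first part and contributes the mean of \<open>\<Sum>d\<in>D (L \<omega>). v d\<close>.\<close>

lemma (in prob_space) moments_le_random_sum:
  fixes L :: "'a \<Rightarrow> 'l :: countable" and Y :: "'d \<Rightarrow> 'a \<Rightarrow> real"
  assumes L: "indep_pair (count_space UNIV) L (\<Pi>\<^sub>M d\<in>UNIV. borel) (\<lambda>\<omega> d. Y d \<omega>)"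
    and Y: "indep_vars (\<lambda>_. borel) Y UNIV"
    and D: "\<And>l. finite (D l)"
    and mom: "\<And>\<omega> d. \<omega> \<in> space M \<Longrightarrow> d \<in> D (L \<omega>) \<Longrightarrow> moments_le (Y d) (m d) (v d)"
    and A: "moments_le (\<lambda>\<omega>. a (L \<omega>) + (\<Sum>d\<in>D (L \<omega>). m d)) \<mu> s"
    and R: "integrable M (\<lambda>\<omega>. \<Sum>d\<in>D (L \<omega>). v d)" "expectation (\<lambda>\<omega>. \<Sum>d\<in>D (L \<omega>). v d) \<le> r"
  shows "moments_le (\<lambda>\<omega>. a (L \<omega>) + (\<Sum>d\<in>D (L \<omega>). Y d \<omega>)) \<mu> (s + r)"
proof -
  have LM [measurable]: "L \<in> M \<rightarrow>\<^sub>M count_space UNIV"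
    using L by (simp add: indep_pair_def)
  have YM [measurable]: "Y d \<in> borel_measurable M" for d
    using Y by (auto simp: indep_vars_def)
  define h where "h l y = a l + (\<Sum>d\<in>D l. y d)" for l and y :: "'d \<Rightarrow> real"
  define A' where "A' l = a l + (\<Sum>d\<in>D l. m d)" for l
  have [measurable]: "h l \<in> borel_measurable (\<Pi>\<^sub>M d\<in>UNIV. borel)" for l
    unfolding h_def by measurable
  have sum: "moments_le (\<lambda>\<omega>'. \<Sum>d\<in>D (L \<omega>). Y d \<omega>') (\<Sum>d\<in>D (L \<omega>). m d) (\<Sum>d\<in>D (L \<omega>). v d)"
    if "\<omega> \<in> space M" for \<omega>
    by (rule moments_le_indep_sum[OF D indep_vars_subset[OF Y]]) (use mom that in auto)
  have hA: "h l (\<lambda>d. Y d \<omega>') = A' l + ((\<Sum>d\<in>D l. Y d \<omega>') - (\<Sum>d\<in>D l. m d))" for l \<omega>'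
    by (simp add: h_def A'_def)
  have hM [measurable]: "(\<lambda>\<omega>. h (L \<omega>) (\<lambda>d. Y d \<omega>)) \<in> borel_measurable M"
    by (rule measurable_compose_countable[OF _ LM]) (simp add: h_def)
  have v: "(\<Sum>d\<in>D (L \<omega>). v d) \<ge> 0" if "\<omega> \<in> space M" for \<omega>
    using sum[OF that] unfolding moments_le_def
    by (meson integral_nonneg order_trans zero_le_power2 Bochner_Integration.integral_nonneg)
  have A2: "integrable M (\<lambda>\<omega>. (A' (L \<omega>) - \<mu>)\<^sup>2)" "expectation (\<lambda>\<omega>. (A' (L \<omega>) - \<mu>)\<^sup>2) \<le> s"
    using A by (auto simp: moments_le_def A'_def)
  \<comment> \<open>Integrability is not known yet, so the second moment is first computed as a nonnegative
    integral; its finiteness then gives integrability of the sum itself.\<close>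
  have "(\<integral>\<^sup>+\<omega>. ennreal ((h (L \<omega>) (\<lambda>d. Y d \<omega>) - \<mu>)\<^sup>2) \<partial>M) =
      (\<integral>\<^sup>+\<omega>. \<integral>\<^sup>+\<omega>'. ennreal ((h (L \<omega>) (\<lambda>d. Y d \<omega>') - \<mu>)\<^sup>2) \<partial>M \<partial>M)"
    by (rule indep_pair_decouple_nn[OF L, of "\<lambda>l y. ennreal ((h l y - \<mu>)\<^sup>2)"]) measurable
  also have "\<dots> \<le> (\<integral>\<^sup>+\<omega>. ennreal ((A' (L \<omega>) - \<mu>)\<^sup>2 + (\<Sum>d\<in>D (L \<omega>). v d)) \<partial>M)"
  proof (rule nn_integral_mono)
    fix \<omega> assume \<omega>: "\<omega> \<in> space M"
    have "(\<integral>\<^sup>+\<omega>'. ennreal ((h (L \<omega>) (\<lambda>d. Y d \<omega>') - \<mu>)\<^sup>2) \<partial>M) =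
        (\<integral>\<^sup>+\<omega>'. ennreal (((A' (L \<omega>) - \<mu>) + ((\<Sum>d\<in>D (L \<omega>). Y d \<omega>') - (\<Sum>d\<in>D (L \<omega>). m d)))\<^sup>2) \<partial>M)"
      by (simp add: hA algebra_simps)
    also have "\<dots> = ennreal (expectation (\<lambda>\<omega>'. ((A' (L \<omega>) - \<mu>) + ((\<Sum>d\<in>D (L \<omega>). Y d \<omega>') - (\<Sum>d\<in>D (L \<omega>). m d)))\<^sup>2))"
      by (rule nn_integral_eq_integral[OF moments_le_second_moment(1)[OF sum[OF \<omega>]]]) simp
    also have "\<dots> \<le> ennreal ((A' (L \<omega>) - \<mu>)\<^sup>2 + (\<Sum>d\<in>D (L \<omega>). v d))"
      by (rule ennreal_leI[OF moments_le_second_moment(2)[OF sum[OF \<omega>]]])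
    finally show "(\<integral>\<^sup>+\<omega>'. ennreal ((h (L \<omega>) (\<lambda>d. Y d \<omega>') - \<mu>)\<^sup>2) \<partial>M) \<le>
      ennreal ((A' (L \<omega>) - \<mu>)\<^sup>2 + (\<Sum>d\<in>D (L \<omega>). v d))" .
  qed
  also have "\<dots> = ennreal (expectation (\<lambda>\<omega>. (A' (L \<omega>) - \<mu>)\<^sup>2 + (\<Sum>d\<in>D (L \<omega>). v d)))"
    by (rule nn_integral_eq_integral) (use A2 R v in auto)
  also have "\<dots> \<le> ennreal (s + r)"
    using A2 R by (intro ennreal_leI) simp
  finally have nn: "(\<integral>\<^sup>+\<omega>. ennreal ((h (L \<omega>) (\<lambda>d. Y d \<omega>) - \<mu>)\<^sup>2) \<partial>M) \<le> ennreal (s + r)" .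
  have sq: "integrable M (\<lambda>\<omega>. (h (L \<omega>) (\<lambda>d. Y d \<omega>) - \<mu>)\<^sup>2)"
    by (rule integrableI_nonneg) (use nn in \<open>auto simp: le_less_trans\<close>)
  have sr: "s + r \<ge> 0"
  proof -
    have "0 \<le> expectation (\<lambda>\<omega>. (A' (L \<omega>) - \<mu>)\<^sup>2)" "0 \<le> expectation (\<lambda>\<omega>. \<Sum>d\<in>D (L \<omega>). v d)"
      using v by (auto intro!: Bochner_Integration.integral_nonneg integral_nonneg_AE)
    then show ?thesis using A2 R by linarith
  qed
  have sq_le: "expectation (\<lambda>\<omega>. (h (L \<omega>) (\<lambda>d. Y d \<omega>) - \<mu>)\<^sup>2) \<le> s + r"
    using nn sr unfolding nn_integral_eq_integral[OF sq AE_I2[OF zero_le_power2]]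
    by (simp add: ennreal_le_iff)
  have "integrable M (\<lambda>\<omega>. h (L \<omega>) (\<lambda>d. Y d \<omega>) - \<mu>)"
    by (rule square_integrable_imp_integrable) (use sq in auto)
  then have "integrable M (\<lambda>\<omega>. (h (L \<omega>) (\<lambda>d. Y d \<omega>) - \<mu>) + \<mu>)"
    by (intro Bochner_Integration.integrable_add) auto
  then have int: "integrable M (\<lambda>\<omega>. h (L \<omega>) (\<lambda>d. Y d \<omega>))"
    by simp
  have "expectation (\<lambda>\<omega>. h (L \<omega>) (\<lambda>d. Y d \<omega>)) =
      expectation (\<lambda>\<omega>. expectation (\<lambda>\<omega>'. h (L \<omega>) (\<lambda>d. Y d \<omega>')))"
    by (rule indep_pair_decouple_integral[OF L, of h]) (use int in simp_all)
  also have "\<dots> = expectation (\<lambda>\<omega>. A' (L \<omega>))"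
  proof (rule Bochner_Integration.integral_cong[OF refl])
    fix \<omega> assume "\<omega> \<in> space M"
    from sum[OF this] show "expectation (\<lambda>\<omega>'. h (L \<omega>) (\<lambda>d. Y d \<omega>')) = A' (L \<omega>)"
      unfolding hA moments_le_def using prob_space by simp
  qed
  also have "\<dots> = \<mu>" using A by (simp add: A'_def moments_le_def)
  finally show ?thesis
    using int sq sq_le by (simp add: moments_le_def h_def)
qed

section \<open>Independence of subtrees\<close>

abbreviation exponential_clock :: "real measure"
  where "exponential_clock \<equiv> density lborel (\<lambda>t. ennreal (exponential_density 1 t))"

definition clock_measure :: "(clock \<Rightarrow> real) measure"
  where "clock_measure = (\<Pi>\<^sub>M x\<in>UNIV. exponential_clock)"

lemma prob_space_exponential_clock: "prob_space exponential_clock"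
  by (rule prob_space_exponential_density) simp

interpretation clocks: prob_space clock_measure
  unfolding clock_measure_def by (intro prob_space_PiM prob_space_exponential_clock)

lemma space_clock_measure [simp]: "space clock_measure = UNIV"
  by (simp add: clock_measure_def space_PiM)

lemma measurable_clock [measurable]: "(\<lambda>\<omega>. \<omega> x) \<in> borel_measurable clock_measure"
proof -
  have "(\<lambda>\<omega>. \<omega> x) \<in> clock_measure \<rightarrow>\<^sub>M exponential_clock"
    unfolding clock_measure_def by (rule measurable_component_singleton) simp
  then show ?thesis by simp
qed

lemma measurable_clock_restrict: "(\<lambda>\<omega>. \<omega> x) \<in> borel_measurable (\<Pi>\<^sub>M x\<in>I. exponential_clock)"
proof (cases "x \<in> I")
  case True
  then have "(\<lambda>\<omega>. \<omega> x) \<in> (\<Pi>\<^sub>M x\<in>I. exponential_clock) \<rightarrow>\<^sub>M exponential_clock"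
    by (rule measurable_component_singleton)
  then show ?thesis by simp
next
  case False
  have "(\<lambda>\<omega>. \<omega> x) \<in> borel_measurable (\<Pi>\<^sub>M x\<in>I. exponential_clock) \<longleftrightarrow>
    (\<lambda>\<omega>. undefined :: real) \<in> borel_measurable (\<Pi>\<^sub>M x\<in>I. exponential_clock)"
    by (rule measurable_cong) (use False in \<open>auto simp: space_PiM PiE_def extensional_def\<close>)
  then show ?thesis by simp
qed

lemma distr_clock: "distr clock_measure exponential_clock (\<lambda>\<omega>. \<omega> x) = exponential_clock"
  unfolding clock_measure_def by (rule distr_PiM_component) (auto intro: prob_space_exponential_clock)

lemma indep_clocks: "clocks.indep_vars (\<lambda>_. exponential_clock) (\<lambda>x \<omega>. \<omega> x) UNIV"
proof (subst clocks.indep_vars_iff_distr_eq_PiM)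
  show "(\<lambda>\<omega>. \<omega> x) \<in> clock_measure \<rightarrow>\<^sub>M exponential_clock" for x
    unfolding clock_measure_def by (rule measurable_component_singleton) simp
  show "distr clock_measure (Pi\<^sub>M UNIV (\<lambda>i. exponential_clock)) (\<lambda>x. \<lambda>i\<in>UNIV. x i) =
    (\<Pi>\<^sub>M i\<in>UNIV. distr clock_measure exponential_clock (\<lambda>\<omega>. \<omega> i))"
    unfolding distr_clock by (simp add: clock_measure_def distr_id restrict_UNIV)
qed auto

lemma measurable_offspring_clocks [measurable]:
  "(\<lambda>\<omega>. offspring T lam \<omega> j u) \<in> clock_measure \<rightarrow>\<^sub>M count_space UNIV"
  by (rule measurable_offspring[where X="\<lambda>\<omega>. \<omega>"]) simp

lemma measurable_branch_shape_clocks [measurable]: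
  "(\<lambda>\<omega>. branch_shape T lam \<omega> j u) \<in> clock_measure \<rightarrow>\<^sub>M count_space UNIV"
  by (rule measurable_branch_shape[where X="\<lambda>\<omega>. \<omega>"]) simp

lemma indep_subtrees:
  "clocks.indep_vars (\<lambda>_. count_space UNIV) (\<lambda>d \<omega>. branch_shape T lam \<omega> (f d) (d # u)) UNIV"
proof -
  have "clocks.indep_vars (\<lambda>d. \<Pi>\<^sub>M x\<in>clocks_below (d # u). exponential_clock)
      (\<lambda>d \<omega>. restrict (\<lambda>x. \<omega> x) (clocks_below (d # u))) UNIV"
    by (rule clocks.indep_vars_restrict[OF indep_clocks])
       (use clocks_below_disjoint in \<open>auto simp: disjoint_family_on_def\<close>)
  then have "clocks.indep_vars (\<lambda>_. count_space UNIV)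
      (\<lambda>d \<omega>. branch_shape T lam (restrict (\<lambda>x. \<omega> x) (clocks_below (d # u))) (f d) (d # u)) UNIV"
    by (rule clocks.indep_vars_compose2)
       (rule measurable_branch_shape[where X="\<lambda>\<omega>. \<omega>"], rule measurable_clock_restrict)
  moreover have "branch_shape T lam (restrict (\<lambda>x. \<omega> x) (clocks_below (d # u))) (f d) (d # u) =
      branch_shape T lam \<omega> (f d) (d # u)" for d \<omega>
    by (rule branch_shape_cong) simp
  ultimately show ?thesis by simp
qed

lemma indep_offspring_subtrees:
  "clocks.indep_pair (count_space UNIV) (\<lambda>\<omega>. offspring T lam \<omega> j u)
     (\<Pi>\<^sub>M d\<in>UNIV. count_space UNIV) (\<lambda>\<omega> d. branch_shape T lam \<omega> (f d) (d # u))"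
proof -
  let ?B = "\<Union>d. clocks_below (d # u)"
  have "clocks.indep_var (\<Pi>\<^sub>M x\<in>own_clocks u. exponential_clock) (\<lambda>\<omega>. restrict (\<lambda>x. \<omega> x) (own_clocks u))
      (\<Pi>\<^sub>M x\<in>?B. exponential_clock) (\<lambda>\<omega>. restrict (\<lambda>x. \<omega> x) ?B)"
    by (rule clocks.indep_var_restrict[OF indep_clocks]) (use own_clocks_disjoint in auto)
  then have "clocks.indep_pair (count_space UNIV)
      (\<lambda>\<omega>. offspring T lam (restrict (\<lambda>x. \<omega> x) (own_clocks u)) j u)
      (\<Pi>\<^sub>M d\<in>UNIV. count_space UNIV)
      (\<lambda>\<omega> d. branch_shape T lam (restrict (\<lambda>x. \<omega> x) ?B) (f d) (d # u))"
  proof (rule clocks.indep_pair_compose)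
    show "(\<lambda>\<omega>. offspring T lam \<omega> j u) \<in> (\<Pi>\<^sub>M x\<in>own_clocks u. exponential_clock) \<rightarrow>\<^sub>M count_space UNIV"
      by (rule measurable_offspring[where X="\<lambda>\<omega>. \<omega>"]) (rule measurable_clock_restrict)
    show "(\<lambda>\<omega> d. branch_shape T lam \<omega> (f d) (d # u)) \<in>
        (\<Pi>\<^sub>M x\<in>?B. exponential_clock) \<rightarrow>\<^sub>M (\<Pi>\<^sub>M d\<in>UNIV. count_space UNIV)"
    proof (rule measurable_PiM_single')
      show "(\<lambda>\<omega>. branch_shape T lam \<omega> (f d) (d # u)) \<in> (\<Pi>\<^sub>M x\<in>?B. exponential_clock) \<rightarrow>\<^sub>M count_space UNIV" for d
        by (rule measurable_branch_shape[where X="\<lambda>\<omega>. \<omega>"]) (rule measurable_clock_restrict)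
    qed auto
  qed
  moreover have "offspring T lam (restrict (\<lambda>x. \<omega> x) (own_clocks u)) j u = offspring T lam \<omega> j u" for \<omega>
    by (rule offspring_cong) simp
  moreover have "branch_shape T lam (restrict (\<lambda>x. \<omega> x) ?B) (f d) (d # u) =
      branch_shape T lam \<omega> (f d) (d # u)" for d \<omega>
    by (rule branch_shape_cong) auto
  ultimately show ?thesis by simp
qed

section \<open>The numbers of offspring\<close>

lemma AE_clock_nonneg: "AE \<omega> in clock_measure. 0 \<le> \<omega> x"
  unfolding clock_measure_def
proof (rule AE_PiM_component)
  show "AE t in exponential_clock. 0 \<le> t"
    by (auto simp: AE_density exponential_density_def)
qed (auto intro: prob_space_exponential_clock)

lemma exponential_clock_tail:
  assumes "a \<ge> 0"
  shows "emeasure exponential_clock {t. a < t} = ennreal (exp (- a))"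
proof -
  interpret prob_space exponential_clock by (rule prob_space_exponential_clock)
  have "distributed exponential_clock lborel (\<lambda>t. t) (exponential_density 1)"
    by (simp add: distributed_def distr_id2)
  from exponential_distributedD_gt[OF this] assms show ?thesis
    by (simp add: emeasure_eq_measure)
qed

text \<open>The product of the two exponentials is, up to the factor \<open>1 / (1 + a)\<close>, the exponential
  density of rate \<open>1 + a\<close>.\<close>

lemma exponential_clock_laplace:
  assumes "a \<ge> 0"
  shows "(\<integral>\<^sup>+t. ennreal (exp (- (a * t))) \<partial>exponential_clock) = ennreal (1 / (1 + a))"
proof -
  have "prob_space (density lborel (\<lambda>t. ennreal (exponential_density (1 + a) t)))"
    by (rule prob_space_exponential_density) (use assms in simp)
  from prob_space.emeasure_space_1[OF this]
  have 1: "(\<integral>\<^sup>+t. ennreal (exponential_density (1 + a) t) \<partial>lborel) = 1"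
    by (simp add: emeasure_density)
  have "(\<integral>\<^sup>+t. ennreal (exp (- (a * t))) \<partial>exponential_clock) =
      (\<integral>\<^sup>+t. ennreal (exponential_density 1 t) * ennreal (exp (- (a * t))) \<partial>lborel)"
    by (rule nn_integral_density) auto
  also have "\<dots> = (\<integral>\<^sup>+t. ennreal (1 / (1 + a)) * ennreal (exponential_density (1 + a) t) \<partial>lborel)"
  proof (rule nn_integral_cong)
    fix t
    have "exp (- t) * exp (- (a * t)) = 1 / (1 + a) * ((1 + a) * exp (- t * (1 + a)))"
      using assms by (simp add: exp_add[symmetric] algebra_simps flip: distrib_left)
        (simp add: field_simps add_nonneg_eq_0_iff)
    then show "ennreal (exponential_density 1 t) * ennreal (exp (- (a * t))) =
        ennreal (1 / (1 + a)) * ennreal (exponential_density (1 + a) t)"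
      using assms by (simp add: exponential_density_def flip: ennreal_mult)
  qed
  also have "\<dots> = ennreal (1 / (1 + a))"
    by (subst nn_integral_cmult) (simp_all add: 1)
  finally show ?thesis .
qed

lemma measurable_unit_arrival [measurable]:
  "(\<lambda>\<omega>. unit_arrival \<omega> u i n) \<in> borel_measurable clock_measure"
  unfolding unit_arrival_def by measurable

lemma unit_arrival_laplace:
  assumes "a \<ge> 0"
  shows "(\<integral>\<^sup>+\<omega>. ennreal (exp (- (a * unit_arrival \<omega> u i n))) \<partial>clock_measure) =
    ennreal ((1 / (1 + a)) ^ Suc n)"
proof -
  let ?G = "Gap u i ` {..n}"
  have inj: "inj_on (Gap u i) {..n}" by (auto simp: inj_on_def)
  have ind: "clocks.indep_vars (\<lambda>_. borel) (\<lambda>x \<omega>. ennreal (exp (- (a * \<omega> x)))) ?G"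
    by (rule clocks.indep_vars_compose2[OF clocks.indep_vars_subset[OF indep_clocks]]) auto
  have one: "(\<integral>\<^sup>+\<omega>. ennreal (exp (- (a * \<omega> x))) \<partial>clock_measure) = ennreal (1 / (1 + a))" for x
  proof -
    have "(\<lambda>\<omega>. \<omega> x) \<in> clock_measure \<rightarrow>\<^sub>M exponential_clock"
      using measurable_clock by simp
    then have "(\<integral>\<^sup>+\<omega>. ennreal (exp (- (a * \<omega> x))) \<partial>clock_measure) =
        (\<integral>\<^sup>+t. ennreal (exp (- (a * t))) \<partial>distr clock_measure exponential_clock (\<lambda>\<omega>. \<omega> x))"
      by (subst nn_integral_distr) auto
    then show ?thesis unfolding distr_clock exponential_clock_laplace[OF assms] .
  qed
  have "ennreal (exp (- (a * unit_arrival \<omega> u i n))) = (\<Prod>x\<in>?G. ennreal (exp (- (a * \<omega> x))))" for \<omega>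
    by (simp add: unit_arrival_def prod.reindex[OF inj] prod_ennreal exp_sum[symmetric]
        sum_distrib_left sum_negf)
  then have "(\<integral>\<^sup>+\<omega>. ennreal (exp (- (a * unit_arrival \<omega> u i n))) \<partial>clock_measure) =
      (\<Prod>x\<in>?G. \<integral>\<^sup>+\<omega>. ennreal (exp (- (a * \<omega> x))) \<partial>clock_measure)"
    using clocks.indep_vars_nn_integral[OF _ ind] by simp
  also have "\<dots> = ennreal (1 / (1 + a)) ^ Suc n"
    by (simp only: one) (simp add: card_image[OF inj])
  finally show ?thesis using assms by (simp add: ennreal_power del: power_Suc)
qed

text \<open>By memorylessness each arrival of a Poisson process of rate \<open>\<theta>\<close> wins against the unit rate
  death clock with probability \<open>\<theta> / (1 + \<theta>)\<close>, independently of the past. Formally, given that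
  the unit rate process has its arrival at time \<open>s\<close>, the death clock exceeds \<open>s / \<theta>\<close> with
  probability \<open>exp (- s / \<theta>)\<close>, and the mean of this is a Laplace transform of the arrival time.\<close>

lemma prob_arrival_before_death:
  assumes "\<theta> \<ge> 0"
  shows "clocks.prob {\<omega>. unit_arrival \<omega> u i n < \<theta> * \<omega> (Life u)} = (\<theta> / (1 + \<theta>)) ^ Suc n"
proof (cases "\<theta> = 0")
  case True
  have "AE \<omega> in clock_measure. \<forall>m. 0 \<le> \<omega> (Gap u i m)"
    by (simp add: AE_all_countable AE_clock_nonneg)
  then have "AE \<omega> in clock_measure. \<not> unit_arrival \<omega> u i n < 0"
    by eventually_elim (simp add: unit_arrival_def sum_nonneg not_less)
  then have "clocks.prob {\<omega>. unit_arrival \<omega> u i n < 0} = 0"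
    using clocks.prob_eq_0[of "{\<omega>. unit_arrival \<omega> u i n < 0}"] borel_measurable_less[OF
        measurable_unit_arrival[of u i n] borel_measurable_const[of 0]] by simp
  then show ?thesis using True by simp
next
  case False
  then have \<theta>: "\<theta> > 0" using assms by simp
  let ?S = "\<lambda>\<omega>. unit_arrival \<omega> u i n" and ?E = "exponential_clock"
  have restr: "clocks.indep_var (\<Pi>\<^sub>M x\<in>Gap u i ` {..n}. ?E) (\<lambda>\<omega>. restrict (\<lambda>x. \<omega> x) (Gap u i ` {..n}))
      (\<Pi>\<^sub>M x\<in>{Life u}. ?E) (\<lambda>\<omega>. restrict (\<lambda>x. \<omega> x) {Life u})"
    by (rule clocks.indep_var_restrict[OF indep_clocks]) auto
  have "clocks.indep_pair borel (\<lambda>\<omega>. unit_arrival (restrict (\<lambda>x. \<omega> x) (Gap u i ` {..n})) u i n)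
      ?E (\<lambda>\<omega>. restrict (\<lambda>x. \<omega> x) {Life u} (Life u))"
  proof (rule clocks.indep_pair_compose[OF restr])
    show "(\<lambda>\<omega>. unit_arrival \<omega> u i n) \<in> borel_measurable (\<Pi>\<^sub>M x\<in>Gap u i ` {..n}. ?E)"
      unfolding unit_arrival_def by (intro borel_measurable_sum measurable_clock_restrict)
    show "(\<lambda>\<omega>. \<omega> (Life u)) \<in> (\<Pi>\<^sub>M x\<in>{Life u}. ?E) \<rightarrow>\<^sub>M ?E"
      by (rule measurable_component_singleton) simp
  qed
  moreover have "unit_arrival (restrict (\<lambda>x. \<omega> x) (Gap u i ` {..n})) u i n = ?S \<omega>" for \<omega>
    by (simp add: unit_arrival_def)
  ultimately have eq: "distr clock_measure (borel \<Otimes>\<^sub>M ?E) (\<lambda>\<omega>. (?S \<omega>, \<omega> (Life u))) =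
      distr clock_measure borel ?S \<Otimes>\<^sub>M ?E"
    by (simp add: clocks.indep_pair_def distr_clock)
  interpret E: prob_space ?E by (rule prob_space_exponential_clock)
  have L [measurable]: "(\<lambda>\<omega>. \<omega> (Life u)) \<in> clock_measure \<rightarrow>\<^sub>M ?E"
    using measurable_clock by simp
  let ?A = "{z :: real \<times> real. fst z < \<theta> * snd z}"
  have A: "?A \<in> sets (borel \<Otimes>\<^sub>M ?E)"
  proof -
    have "{z \<in> space (borel \<Otimes>\<^sub>M borel). fst z < \<theta> * snd z} \<in> sets (borel \<Otimes>\<^sub>M borel)"
      by measurable
    then have "?A \<in> sets (borel \<Otimes>\<^sub>M borel)" by (simp add: space_pair_measure)
    moreover have "sets (borel \<Otimes>\<^sub>M ?E) = sets (borel \<Otimes>\<^sub>M borel)"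
      by (rule sets_pair_measure_cong) auto
    ultimately show ?thesis by simp
  qed
  have "emeasure clock_measure {\<omega>. ?S \<omega> < \<theta> * \<omega> (Life u)} =
      emeasure (distr clock_measure (borel \<Otimes>\<^sub>M ?E) (\<lambda>\<omega>. (?S \<omega>, \<omega> (Life u)))) ?A"
    using A by (subst emeasure_distr) (auto simp: vimage_def)
  also have "\<dots> = (\<integral>\<^sup>+s. emeasure ?E (Pair s -` ?A) \<partial>distr clock_measure borel ?S)"
    unfolding eq using A by (intro E.emeasure_pair_measure_alt) (simp cong: sets_pair_measure_cong)
  also have "\<dots> = (\<integral>\<^sup>+\<omega>. emeasure ?E {t. ?S \<omega> / \<theta> < t} \<partial>clock_measure)"
    using A \<theta>
    by (subst nn_integral_distr)
       (auto intro!: E.measurable_emeasure_Pair nn_integral_cong arg_cong[where f="emeasure ?E"]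
         simp: field_simps vimage_def)
  also have "\<dots> = (\<integral>\<^sup>+\<omega>. ennreal (exp (- (1 / \<theta> * ?S \<omega>))) \<partial>clock_measure)"
  proof (rule nn_integral_cong_AE)
    have "AE \<omega> in clock_measure. \<forall>m. 0 \<le> \<omega> (Gap u i m)"
      by (simp add: AE_all_countable AE_clock_nonneg)
    then show "AE \<omega> in clock_measure. emeasure ?E {t. ?S \<omega> / \<theta> < t} = ennreal (exp (- (1 / \<theta> * ?S \<omega>)))"
    proof eventually_elim
      case (elim \<omega>)
      then have "?S \<omega> \<ge> 0" by (simp add: unit_arrival_def sum_nonneg)
      then show ?case using exponential_clock_tail[of "?S \<omega> / \<theta>"] \<theta> by simp
    qed
  qed
  also have "\<dots> = ennreal ((1 / (1 + 1 / \<theta>)) ^ Suc n)"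
    by (rule unit_arrival_laplace) (use \<theta> in simp)
  also have "1 / (1 + 1 / \<theta>) = \<theta> / (1 + \<theta>)"
    using \<theta> by (simp add: field_simps)
  finally show ?thesis
    using \<theta> by (simp add: clocks.emeasure_eq_measure del: power_Suc)
qed

text \<open>Among all sets of the same size the sum on the right is smallest for \<open>A = {..<card A}\<close>. It allows second moments of
  the number of offspring to be bounded by a weighted sum of probabilities of single births.\<close>

lemma card_square_le:
  assumes "finite (A :: nat set)"
  shows "(card A)\<^sup>2 \<le> (\<Sum>n\<in>A. 2 * Suc n)"
  using assms
proof (induction A rule: finite_linorder_max_induct)
  case empty
  then show ?case by simp
next
  case (insert b A)
  have "A \<subseteq> {..<b}" using insert by auto
  then have "card A \<le> b" by (metis card_lessThan card_mono finite_lessThan)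
  then show ?case using insert by (auto simp: power2_eq_square)
qed

definition offspring_count ::
  "(nat \<Rightarrow> real) \<Rightarrow> (nat \<Rightarrow> real) \<Rightarrow> nat \<Rightarrow> descent list \<Rightarrow> nat \<Rightarrow> (clock \<Rightarrow> real) \<Rightarrow> nat"
  where "offspring_count T lam j u i \<omega> = card {n. (i, n) \<in> set (offspring T lam \<omega> j u)}"

lemma set_offspring:
  "(i, n) \<in> set (offspring T lam \<omega> j u) \<longleftrightarrow>
    1 \<le> i \<and> i < j \<and> finite (offspring_indices T lam \<omega> j u i) \<and> n \<in> offspring_indices T lam \<omega> j u i"
proof -
  have "set (sorted_list_of_set A) = (if finite A then A else {})" for A :: "nat set"
    by simp
  then show ?thesis by (auto simp: offspring_def split: if_splits)
qed

lemma distinct_offspring: "distinct (offspring T lam \<omega> j u)"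
proof -
  have "distinct (concat (map (\<lambda>i. map (Pair i) (f i)) xs))"
    if "distinct xs" "\<And>i. distinct (f i)" for xs :: "nat list" and f :: "nat \<Rightarrow> nat list"
    using that by (induction xs) (auto simp: distinct_map inj_on_def)
  then show ?thesis by (simp add: offspring_def)
qed

lemma sum_offspring:
  "(\<Sum>(i, n)\<in>set (offspring T lam \<omega> j u). f i) =
    (\<Sum>i=1..<j. real (offspring_count T lam j u i \<omega>) * f i)"
proof -
  have "set (offspring T lam \<omega> j u) = Sigma {1..<j} (\<lambda>i. {n. (i, n) \<in> set (offspring T lam \<omega> j u)})"
    by (auto simp: set_offspring)
  moreover have "finite {n. (i, n) \<in> set (offspring T lam \<omega> j u)}" for i
    by (rule finite_imageD[where f="Pair i"])
      (auto intro: finite_subset[OF _ finite_set[of "offspring T lam \<omega> j u"]] simp: inj_on_def)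
  ultimately have "(\<Sum>(i, n)\<in>set (offspring T lam \<omega> j u). f i) =
      (\<Sum>i=1..<j. \<Sum>n\<in>{n. (i, n) \<in> set (offspring T lam \<omega> j u)}. f i)"
    by (subst sum.Sigma) auto
  then show ?thesis by (simp add: offspring_count_def)
qed

lemma measurable_offspring_count [measurable]:
  "(\<lambda>\<omega>. real (offspring_count T lam j u i \<omega>)) \<in> borel_measurable clock_measure"
  unfolding offspring_count_def
  by (rule measurable_compose[OF measurable_offspring_clocks]) simp

text \<open>The number of offspring of one order is geometric with mean \<open>T (j - i)\<close>. Both moments come from
  the probabilities of the events \<open>B n\<close> that the \<open>n\<close>-th birth takes place.\<close>

lemma offspring_count_moments:
  fixes u :: "descent list"
  assumes i: "1 \<le> i" "i < j" and T: "T (j - i) \<ge> 0" and lam: "lam j > 0"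
  defines "C \<equiv> \<lambda>\<omega>. real (offspring_count T lam j u i \<omega>)"
  shows "integrable clock_measure C" "clocks.expectation C = T (j - i)"
    "integrable clock_measure (\<lambda>\<omega>. (C \<omega>)\<^sup>2)" "clocks.expectation (\<lambda>\<omega>. (C \<omega>)\<^sup>2) \<le> 2 * (T (j - i) + 1)\<^sup>2"
proof -
  let ?t = "T (j - i)"
  define r where "r = ?t / (1 + ?t)"
  have r: "0 \<le> r" "r < 1" and r1: "1 - r = 1 / (1 + ?t)"
    using T by (auto simp: r_def field_simps)
  define I where "I \<omega> = offspring_indices T lam \<omega> j u i" for \<omega>
  have I: "n \<in> I \<omega> \<longleftrightarrow> unit_arrival \<omega> u i n < ?t * \<omega> (Life u)" for n \<omega>
    using lam by (simp add: I_def offspring_indices_def offspring_rate_def lifetime_def)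
  define B where "B n = {\<omega>. n \<in> I \<omega>}" for n
  have B [measurable]: "B n \<in> sets clock_measure" for n
  proof -
    have "{\<omega> \<in> space clock_measure. unit_arrival \<omega> u i n < ?t * \<omega> (Life u)} \<in> sets clock_measure"
      by measurable
    then show ?thesis by (simp add: B_def I)
  qed
  have PB: "clocks.prob (B n) = r ^ Suc n" for n
    unfolding B_def I r_def by (rule prob_arrival_before_death[OF T])
  have C: "C \<omega> = (if finite (I \<omega>) then card (I \<omega>) else 0)" for \<omega>
    using i by (auto simp: C_def offspring_count_def set_offspring I_def)
  have Cm [measurable]: "C \<in> borel_measurable clock_measure"
    unfolding C_def by measurable
  have geo: "(\<lambda>n. r ^ Suc n) sums ?t"
  proof -
    have "(\<lambda>n. r * r ^ n) sums (r * (1 / (1 - r)))"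
      using r by (intro sums_mult geometric_sums) simp
    moreover have "r * (1 / (1 - r)) = ?t" unfolding r1 using T by (simp add: r_def)
    ultimately show ?thesis by simp
  qed
  have "AE \<omega> in clock_measure. eventually (\<lambda>n. \<omega> \<in> space clock_measure - B n) sequentially"
    by (rule borel_cantelli_AE1) (use geo PB in \<open>auto simp: sums_iff clocks.emeasure_eq_measure\<close>)
  then have fin: "AE \<omega> in clock_measure. finite (I \<omega>)"
  proof eventually_elim
    case (elim \<omega>)
    then obtain N where "\<And>n. n \<ge> N \<Longrightarrow> n \<notin> I \<omega>"
      unfolding eventually_sequentially B_def by auto
    then have "I \<omega> \<subseteq> {..<N}" by (meson lessThan_iff not_le subsetI)
    then show ?case using finite_subset by blast
  qed
  \<comment> \<open>Weight 1 gives the mean; weight \<open>2 * Suc n\<close> dominates the square of the number of births.\<close>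
  have weighted: "(\<integral>\<^sup>+\<omega>. ennreal (\<Sum>n\<in>I \<omega>. f n) \<partial>clock_measure) = ennreal s"
    if f: "\<And>n. f n \<ge> 0" and s: "(\<lambda>n. f n * r ^ Suc n) sums s" for f s
  proof -
    have "(\<integral>\<^sup>+\<omega>. ennreal (\<Sum>n\<in>I \<omega>. f n) \<partial>clock_measure) =
        (\<integral>\<^sup>+\<omega>. (\<Sum>n. ennreal (f n) * indicator (B n) \<omega>) \<partial>clock_measure)"
    proof (rule nn_integral_cong_AE)
      show "AE \<omega> in clock_measure. ennreal (\<Sum>n\<in>I \<omega>. f n) = (\<Sum>n. ennreal (f n) * indicator (B n) \<omega>)"
        using fin
      proof eventually_elim
        case (elim \<omega>)
        have "(\<Sum>n. ennreal (f n) * indicator (B n) \<omega>) = (\<Sum>n\<in>I \<omega>. ennreal (f n) * indicator (B n) \<omega>)"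
          by (rule suminf_finite[OF elim]) (simp add: B_def)
        also have "\<dots> = (\<Sum>n\<in>I \<omega>. ennreal (f n))"
          by (rule sum.cong) (auto simp: B_def)
        finally show ?case using f by (simp add: sum_ennreal)
      qed
    qed
    also have "\<dots> = (\<Sum>n. ennreal (f n * r ^ Suc n))"
      using f r
      by (subst nn_integral_suminf)
         (auto simp: nn_integral_cmult_indicator clocks.emeasure_eq_measure PB ennreal_mult simp del: power_Suc)
    also have "\<dots> = ennreal s"
      using s f r by (subst suminf_ennreal2) (auto simp: sums_iff simp del: power_Suc)
    finally show ?thesis .
  qed
  have "(\<integral>\<^sup>+\<omega>. ennreal (C \<omega>) \<partial>clock_measure) = (\<integral>\<^sup>+\<omega>. ennreal (\<Sum>n\<in>I \<omega>. 1) \<partial>clock_measure)"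
    by (rule nn_integral_cong) (simp add: C)
  also have "\<dots> = ennreal ?t"
    by (rule weighted) (use geo in simp_all)
  finally have nn1: "(\<integral>\<^sup>+\<omega>. ennreal (C \<omega>) \<partial>clock_measure) = ennreal ?t" .
  show "integrable clock_measure C"
    by (rule integrableI_nn_integral_finite[OF Cm _ nn1]) (simp add: C)
  show "clocks.expectation C = ?t"
    using nn1 T by (subst integral_eq_nn_integral) (auto simp: C)
  have "(\<lambda>n. 2 * r * (of_nat (Suc n) * r ^ n)) sums (2 * r * (1 / (1 - r)\<^sup>2))"
    using r by (intro sums_mult geometric_deriv_sums) simp
  moreover have "(\<lambda>n. 2 * r * (of_nat (Suc n) * r ^ n)) = (\<lambda>n. 2 * real (Suc n) * r ^ Suc n)"
    by (simp add: fun_eq_iff)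
  moreover have "2 * r * (1 / (1 - r)\<^sup>2) = 2 * ?t * (1 + ?t)"
    unfolding r1 using T by (simp add: r_def power_divide power2_eq_square)
  ultimately have s2: "(\<lambda>n. 2 * real (Suc n) * r ^ Suc n) sums (2 * ?t * (1 + ?t))"
    by simp
  have C2: "(C \<omega>)\<^sup>2 \<le> (\<Sum>n\<in>I \<omega>. 2 * real (Suc n))" for \<omega>
  proof (cases "finite (I \<omega>)")
    case True
    have "real ((card (I \<omega>))\<^sup>2) \<le> real (\<Sum>n\<in>I \<omega>. 2 * Suc n)"
      using card_square_le[OF True] of_nat_le_iff by blast
    then show ?thesis using True by (simp add: C)
  qed (simp add: C)
  have "(\<integral>\<^sup>+\<omega>. ennreal ((C \<omega>)\<^sup>2) \<partial>clock_measure) \<le>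
      (\<integral>\<^sup>+\<omega>. ennreal (\<Sum>n\<in>I \<omega>. 2 * real (Suc n)) \<partial>clock_measure)"
    by (rule nn_integral_mono) (rule ennreal_leI[OF C2])
  also have "\<dots> = ennreal (2 * ?t * (1 + ?t))"
    by (rule weighted) (use s2 in simp_all)
  finally have nn2: "(\<integral>\<^sup>+\<omega>. ennreal ((C \<omega>)\<^sup>2) \<partial>clock_measure) \<le> ennreal (2 * ?t * (1 + ?t))" .
  show sq: "integrable clock_measure (\<lambda>\<omega>. (C \<omega>)\<^sup>2)"
    by (rule integrableI_nonneg) (use nn2 in \<open>auto simp: le_less_trans\<close>)
  have "clocks.expectation (\<lambda>\<omega>. (C \<omega>)\<^sup>2) \<le> 2 * ?t * (1 + ?t)"
    using nn2 T unfolding nn_integral_eq_integral[OF sq AE_I2[OF zero_le_power2]]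
    by (simp add: ennreal_le_iff)
  also have "\<dots> \<le> 2 * (?t + 1)\<^sup>2"
    using T by (simp add: power2_eq_square algebra_simps)
  finally show "clocks.expectation (\<lambda>\<omega>. (C \<omega>)\<^sup>2) \<le> 2 * (?t + 1)\<^sup>2" .
qed

lemma weighted_sum_square_le:
  fixes q x :: "'i \<Rightarrow> real"
  assumes "\<And>i. i \<in> I \<Longrightarrow> q i \<ge> 0"
  shows "(\<Sum>i\<in>I. q i * x i)\<^sup>2 \<le> (\<Sum>i\<in>I. q i) * (\<Sum>i\<in>I. q i * (x i)\<^sup>2)"
proof -
  have "(\<Sum>i\<in>I. sqrt (q i) * (sqrt (q i) * x i))\<^sup>2 \<le>
      (\<Sum>i\<in>I. (sqrt (q i))\<^sup>2) * (\<Sum>i\<in>I. (sqrt (q i) * x i)\<^sup>2)"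
    by (rule Cauchy_Schwarz_ineq_sum)
  moreover have "(\<Sum>i\<in>I. sqrt (q i) * (sqrt (q i) * x i)) = (\<Sum>i\<in>I. q i * x i)"
    by (rule sum.cong) (use assms in \<open>auto simp flip: mult.assoc\<close>)
  moreover have "(\<Sum>i\<in>I. (sqrt (q i))\<^sup>2) = (\<Sum>i\<in>I. q i)"
    by (rule sum.cong) (use assms in auto)
  moreover have "(\<Sum>i\<in>I. (sqrt (q i) * x i)\<^sup>2) = (\<Sum>i\<in>I. q i * (x i)\<^sup>2)"
    by (rule sum.cong) (use assms in \<open>auto simp: power_mult_distrib\<close>)
  ultimately show ?thesis by simp
qed

text \<open>The numbers of offspring of different orders are correlated through the common lifetime of
  the parent. The Cauchy-Schwarz inequality with weights \<open>(T (j - i) + 1) * b i\<close> needs only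
  their individual second moments.\<close>

lemma moments_le_offspring_sum:
  assumes T: "\<And>k. k \<ge> 1 \<Longrightarrow> T k \<ge> 0" and lam: "lam j > 0"
    and b: "\<And>i. 1 \<le> i \<Longrightarrow> i < j \<Longrightarrow> \<bar>f i\<bar> \<le> b i"
  shows "clocks.moments_le (\<lambda>\<omega>. \<Sum>(i, n)\<in>set (offspring T lam \<omega> j u). f i)
    (\<Sum>i=1..<j. T (j - i) * f i) (2 * (\<Sum>i=1..<j. (T (j - i) + 1) * b i)\<^sup>2)"
proof -
  define C where "C i \<omega> = real (offspring_count T lam j u i \<omega>)" for i \<omega>
  define X where "X \<omega> = (\<Sum>i=1..<j. C i \<omega> * f i)" for \<omega>
  define q where "q i = (T (j - i) + 1) * b i" for i
  define x where "x i \<omega> = C i \<omega> / (T (j - i) + 1)" for i \<omega>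
  have t: "T (j - i) \<ge> 0" if "i \<in> {1..<j}" for i
  proof -
    have "j - i \<ge> 1" using that by auto
    then show ?thesis by (rule T)
  qed
  have mom: "integrable clock_measure (C i)" "clocks.expectation (C i) = T (j - i)"
    "integrable clock_measure (\<lambda>\<omega>. (C i \<omega>)\<^sup>2)"
    "clocks.expectation (\<lambda>\<omega>. (C i \<omega>)\<^sup>2) \<le> 2 * (T (j - i) + 1)\<^sup>2"
    if "i \<in> {1..<j}" for i
    using offspring_count_moments[of i j T lam u] t[OF that] lam that unfolding C_def by auto
  have X: "(\<Sum>(i, n)\<in>set (offspring T lam \<omega> j u). f i) = X \<omega>" for \<omega>
    unfolding X_def C_def by (rule sum_offspring)
  have intX: "integrable clock_measure X"
    unfolding X_def using mom by (intro Bochner_Integration.integrable_sum) auto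
  have EX: "clocks.expectation X = (\<Sum>i=1..<j. T (j - i) * f i)"
    unfolding X_def using mom by (subst Bochner_Integration.integral_sum) auto
  have q: "q i \<ge> 0" if "i \<in> {1..<j}" for i
    using t[OF that] b[of i] that unfolding q_def
    by (intro mult_nonneg_nonneg) (auto intro: order_trans[OF abs_ge_zero])
  have x2: "integrable clock_measure (\<lambda>\<omega>. (x i \<omega>)\<^sup>2)" "clocks.expectation (\<lambda>\<omega>. (x i \<omega>)\<^sup>2) \<le> 2"
    if "i \<in> {1..<j}" for i
    using mom(3,4)[OF that] t[OF that] by (auto simp: x_def power_divide field_simps)
  have X2: "(X \<omega>)\<^sup>2 \<le> (\<Sum>i=1..<j. q i) * (\<Sum>i=1..<j. q i * (x i \<omega>)\<^sup>2)" for \<omega>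
  proof -
    have "\<bar>X \<omega>\<bar> \<le> (\<Sum>i=1..<j. \<bar>C i \<omega> * f i\<bar>)" unfolding X_def by (rule sum_abs)
    also have "\<dots> \<le> (\<Sum>i=1..<j. q i * x i \<omega>)"
    proof (rule sum_mono)
      fix i assume i: "i \<in> {1..<j}"
      have "\<bar>C i \<omega> * f i\<bar> \<le> C i \<omega> * b i"
        using b[of i] i by (simp add: abs_mult C_def mult_left_mono)
      also have "\<dots> = q i * x i \<omega>" using t[OF i] by (simp add: q_def x_def)
      finally show "\<bar>C i \<omega> * f i\<bar> \<le> q i * x i \<omega>" .
    qed
    finally have "(X \<omega>)\<^sup>2 \<le> (\<Sum>i=1..<j. q i * x i \<omega>)\<^sup>2"
      by (metis abs_ge_zero power2_abs power_mono)
    also have "\<dots> \<le> (\<Sum>i=1..<j. q i) * (\<Sum>i=1..<j. q i * (x i \<omega>)\<^sup>2)"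
      by (rule weighted_sum_square_le) (rule q)
    finally show ?thesis .
  qed
  have ib: "integrable clock_measure (\<lambda>\<omega>. (\<Sum>i=1..<j. q i) * (\<Sum>i=1..<j. q i * (x i \<omega>)\<^sup>2))"
    using x2 by (intro integrable_mult_right Bochner_Integration.integrable_sum) auto
  have sqX: "integrable clock_measure (\<lambda>\<omega>. (X \<omega>)\<^sup>2)"
  proof (rule Bochner_Integration.integrable_bound[OF ib])
    show "(\<lambda>\<omega>. (X \<omega>)\<^sup>2) \<in> borel_measurable clock_measure" using intX by simp
    show "AE \<omega> in clock_measure. norm ((X \<omega>)\<^sup>2) \<le>
        norm ((\<Sum>i=1..<j. q i) * (\<Sum>i=1..<j. q i * (x i \<omega>)\<^sup>2))"
    proof (rule AE_I2)
      fix \<omega>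
      show "norm ((X \<omega>)\<^sup>2) \<le> norm ((\<Sum>i=1..<j. q i) * (\<Sum>i=1..<j. q i * (x i \<omega>)\<^sup>2))"
        using order_trans[OF X2[of \<omega>] abs_ge_self] by simp
    qed
  qed
  have "clocks.expectation (\<lambda>\<omega>. (X \<omega>)\<^sup>2) \<le>
      clocks.expectation (\<lambda>\<omega>. (\<Sum>i=1..<j. q i) * (\<Sum>i=1..<j. q i * (x i \<omega>)\<^sup>2))"
    by (rule integral_mono[OF sqX ib X2])
  also have "\<dots> = (\<Sum>i=1..<j. q i) * (\<Sum>i=1..<j. q i * clocks.expectation (\<lambda>\<omega>. (x i \<omega>)\<^sup>2))"
    using x2 by (simp add: Bochner_Integration.integral_sum)
  also have "\<dots> \<le> (\<Sum>i=1..<j. q i) * (\<Sum>i=1..<j. q i * 2)"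
    using q x2 by (intro mult_left_mono sum_mono sum_nonneg) auto
  also have "\<dots> = 2 * (\<Sum>i=1..<j. q i)\<^sup>2"
    by (simp add: power2_eq_square flip: sum_distrib_right)
  finally have EX2: "clocks.expectation (\<lambda>\<omega>. (X \<omega>)\<^sup>2) \<le> 2 * (\<Sum>i=1..<j. q i)\<^sup>2" .
  let ?\<mu> = "\<Sum>i=1..<j. T (j - i) * f i"
  have "(X \<omega> - ?\<mu>)\<^sup>2 = (X \<omega>)\<^sup>2 - 2 * ?\<mu> * X \<omega> + ?\<mu>\<^sup>2" for \<omega>
    by (simp add: power2_eq_square algebra_simps)
  then have "integrable clock_measure (\<lambda>\<omega>. (X \<omega> - ?\<mu>)\<^sup>2)"
    "clocks.expectation (\<lambda>\<omega>. (X \<omega> - ?\<mu>)\<^sup>2) = clocks.expectation (\<lambda>\<omega>. (X \<omega>)\<^sup>2) - ?\<mu>\<^sup>2"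
    using sqX intX EX clocks.prob_space[unfolded space_clock_measure] by (simp_all add: power2_eq_square)
  moreover have "clocks.expectation (\<lambda>\<omega>. (X \<omega>)\<^sup>2) - ?\<mu>\<^sup>2 \<le> 2 * (\<Sum>i=1..<j. q i)\<^sup>2"
    using EX2 zero_le_power2[of ?\<mu>] by linarith
  ultimately show ?thesis
    using intX EX unfolding X clocks.moments_le_def q_def by presburger
qed

section \<open>Moments of additive functionals\<close>

lemma (in prob_space) moments_le_shift:
  assumes "moments_le X m v"
  shows "moments_le (\<lambda>\<omega>. c + X \<omega>) (c + m) v"
  using assms prob_space by (simp add: moments_le_def)

lemma (in prob_space) moments_le_mono:
  assumes "moments_le X m v" "v \<le> v'"
  shows "moments_le X m v'"
  using assms by (simp add: moments_le_def)

primrec child_order :: "nat \<Rightarrow> descent \<Rightarrow> nat" where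
  "child_order j (Side i n) = i"
| "child_order j (Split b) = j - 1"

definition children :: "nat \<Rightarrow> (nat \<times> nat) list \<Rightarrow> descent set"
  where "children j ys = (\<lambda>(i, n). Side i n) ` set ys \<union> (if j \<ge> 2 then {Split False, Split True} else {})"

lemma finite_children: "finite (children j ys)"
  by (simp add: children_def)

lemma sum_children:
  "(\<Sum>d\<in>children j ys. f d) =
    (\<Sum>(i, n)\<in>set ys. f (Side i n)) + (if j \<ge> 2 then f (Split False) + f (Split True) else 0)"
proof -
  have "inj_on (\<lambda>(i, n). Side i n) (set ys)" by (auto simp: inj_on_def)
  then have "(\<Sum>d\<in>(\<lambda>(i, n). Side i n) ` set ys. f d) = (\<Sum>(i, n)\<in>set ys. f (Side i n))"
    by (subst sum.reindex) (auto simp: case_prod_beta comp_def)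
  then show ?thesis
    unfolding children_def by (subst sum.union_disjoint) auto
qed

lemma order_sum_children:
  assumes "j \<ge> 1"
  shows "order_sum w (branch_shape T lam \<omega> j u) =
    w j + (\<Sum>(i, n)\<in>set (offspring T lam \<omega> j u). w j) +
    (\<Sum>d\<in>children j (offspring T lam \<omega> j u). order_sum w (branch_shape T lam \<omega> (child_order j d) (d # u)))"
  unfolding order_sum_branch_shape[OF assms] sum_children
  by (simp add: sum_list_distinct_conv_sum_set[OF distinct_offspring] case_prod_beta sum.distrib)

text \<open>One generation of the branching process. The first summand of the variance bound comes from the
  fluctuation of the offspring numbers, the rest from the independent subtrees.\<close>

lemma moments_le_branch:
  assumes j: "j \<ge> 1" and T: "\<And>k. k \<ge> 1 \<Longrightarrow> T k \<ge> 0" and lam: "lam j > 0"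
    and mom: "\<And>i d. 1 \<le> i \<Longrightarrow> i < j \<Longrightarrow>
      clocks.moments_le (\<lambda>\<omega>. order_sum w (branch_shape T lam \<omega> i (d # u))) (m i) (v i)"
    and b: "\<And>i. 1 \<le> i \<Longrightarrow> i < j \<Longrightarrow> \<bar>w j + m i\<bar> \<le> b i"
  shows "clocks.moments_le (\<lambda>\<omega>. order_sum w (branch_shape T lam \<omega> j u))
    (w j + (\<Sum>i=1..<j. T (j - i) * (w j + m i)) + (if j \<ge> 2 then 2 * m (j - 1) else 0))
    (2 * (\<Sum>i=1..<j. (T (j - i) + 1) * b i)\<^sup>2 +
      ((\<Sum>i=1..<j. T (j - i) * v i) + (if j \<ge> 2 then 2 * v (j - 1) else 0)))"
  unfolding order_sum_children[OF j]
proof (rule clocks.moments_le_random_sum[where m="\<lambda>d. m (child_order j d)" and v="\<lambda>d. v (child_order j d)"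
      and a="\<lambda>ys. w j + (\<Sum>(i, n)\<in>set ys. w j)"])
  let ?L = "\<lambda>\<omega>. offspring T lam \<omega> j u"
  show "clocks.indep_pair (count_space UNIV) ?L (\<Pi>\<^sub>M d\<in>UNIV. borel)
     (\<lambda>\<omega> d. order_sum w (branch_shape T lam \<omega> (child_order j d) (d # u)))"
    by (rule clocks.indep_pair_compose2[OF indep_offspring_subtrees,
          where g="\<lambda>y d. order_sum w (y d)"])
       (auto intro!: measurable_PiM_single' measurable_compose[OF measurable_component_singleton])
  show "clocks.indep_vars (\<lambda>_. borel)
     (\<lambda>d \<omega>. order_sum w (branch_shape T lam \<omega> (child_order j d) (d # u))) UNIV"
    by (rule clocks.indep_vars_compose2[OF indep_subtrees]) simp
  show "finite (children j ys)" for ys by (rule finite_children)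
  show "clocks.moments_le (\<lambda>\<omega>. order_sum w (branch_shape T lam \<omega> (child_order j d) (d # u)))
      (m (child_order j d)) (v (child_order j d))" if "d \<in> children j (?L \<omega>)" for d \<omega>
    by (rule mom) (use that in \<open>auto simp: children_def set_offspring split: if_splits\<close>)
  have "clocks.moments_le (\<lambda>\<omega>. \<Sum>(i, n)\<in>set (?L \<omega>). w j + m i)
    (\<Sum>i=1..<j. T (j - i) * (w j + m i)) (2 * (\<Sum>i=1..<j. (T (j - i) + 1) * b i)\<^sup>2)"
    by (rule moments_le_offspring_sum[of T lam j "\<lambda>i. w j + m i", OF T lam b])
  note A = clocks.moments_le_shift[OF this, of "w j + (if j \<ge> 2 then 2 * m (j - 1) else 0)"]
  show "clocks.moments_le
      (\<lambda>\<omega>. w j + (\<Sum>(i, n)\<in>set (?L \<omega>). w j) + (\<Sum>d\<in>children j (?L \<omega>). m (child_order j d)))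
      (w j + (\<Sum>i=1..<j. T (j - i) * (w j + m i)) + (if j \<ge> 2 then 2 * m (j - 1) else 0))
      (2 * (\<Sum>i=1..<j. (T (j - i) + 1) * b i)\<^sup>2)"
  proof -
    have "w j + (\<Sum>(i, n)\<in>set (?L \<omega>). w j) + (\<Sum>d\<in>children j (?L \<omega>). m (child_order j d)) =
        w j + (if j \<ge> 2 then 2 * m (j - 1) else 0) + (\<Sum>(i, n)\<in>set (?L \<omega>). w j + m i)" for \<omega>
      by (simp add: sum_children sum.distrib case_prod_beta)
    moreover have "w j + (\<Sum>i=1..<j. T (j - i) * (w j + m i)) + (if j \<ge> 2 then 2 * m (j - 1) else 0) =
        w j + (if j \<ge> 2 then 2 * m (j - 1) else 0) + (\<Sum>i=1..<j. T (j - i) * (w j + m i))"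
      by (simp only: add.assoc add.commute add.left_commute)
    ultimately show ?thesis
      using A by (simp only:)
  qed
  have V: "clocks.moments_le (\<lambda>\<omega>. \<Sum>(i, n)\<in>set (?L \<omega>). v i)
    (\<Sum>i=1..<j. T (j - i) * v i) (2 * (\<Sum>i=1..<j. (T (j - i) + 1) * \<bar>v i\<bar>)\<^sup>2)"
    by (rule moments_le_offspring_sum[of T lam j v, OF T lam]) auto
  have sum: "(\<Sum>d\<in>children j (?L \<omega>). v (child_order j d)) =
    (if j \<ge> 2 then 2 * v (j - 1) else 0) + (\<Sum>(i, n)\<in>set (?L \<omega>). v i)" for \<omega>
    by (simp add: sum_children)
  note V' = clocks.moments_le_shift[OF V, of "if j \<ge> 2 then 2 * v (j - 1) else 0", folded sum]
  then show "integrable clock_measure (\<lambda>\<omega>. \<Sum>d\<in>children j (?L \<omega>). v (child_order j d))"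
    by (simp add: clocks.moments_le_def)
  from V' show "clocks.expectation (\<lambda>\<omega>. \<Sum>d\<in>children j (?L \<omega>). v (child_order j d)) \<le>
      (\<Sum>i=1..<j. T (j - i) * v i) + (if j \<ge> 2 then 2 * v (j - 1) else 0)"
    by (simp add: clocks.moments_le_def)
qed

section \<open>Tokunaga coefficients and mean vertex counts\<close>

text \<open>The convolution with the Tokunaga coefficients, that is, the expectation of the sum of \<open>f\<close> over
  the orders of the side branches of a branch of order \<open>j\<close>.\<close>

definition tok_conv :: "real \<Rightarrow> (nat \<Rightarrow> real) \<Rightarrow> nat \<Rightarrow> real"
  where "tok_conv c f j = (\<Sum>i=1..<j. tokunaga_coeff c (j - i) * f i)"

lemma tok_conv_1: "tok_conv c f (Suc 0) = 0"
  by (simp add: tok_conv_def)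

text \<open>Since the coefficients form a geometric progression, the convolution satisfies a first-order
  recursion, from which all closed forms below follow by induction.\<close>

lemma tok_conv_Suc:
  assumes "j \<ge> 1"
  shows "tok_conv c f (Suc j) = c * tok_conv c f j + (c - 1) * f j"
proof -
  have "{1..<Suc j} = insert j {1..<j}" using assms by auto
  then have "tok_conv c f (Suc j) = (\<Sum>i=1..<j. tokunaga_coeff c (Suc j - i) * f i) + (c - 1) * f j"
    by (simp add: tok_conv_def tokunaga_coeff_def)
  also have "(\<Sum>i=1..<j. tokunaga_coeff c (Suc j - i) * f i) =
      (\<Sum>i=1..<j. c * (tokunaga_coeff c (j - i) * f i))"
  proof (rule sum.cong[OF refl])
    fix i assume "i \<in> {1..<j}"
    then have "j - i = Suc (j - i - 1)" "Suc j - i = Suc (Suc (j - i - 1))" by auto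
    then show "tokunaga_coeff c (Suc j - i) * f i = c * (tokunaga_coeff c (j - i) * f i)"
      by (metis (no_types, lifting) diff_Suc_1 mult.assoc mult.left_commute power_Suc tokunaga_coeff_def)
  qed
  finally show ?thesis by (simp add: tok_conv_def sum_distrib_left)
qed

lemma tok_conv_const:
  assumes "j \<ge> 1"
  shows "tok_conv c (\<lambda>_. a) j = a * (c ^ (j - 1) - 1)"
  using assms
proof (induction j rule: nat_induct_at_least)
  case base
  then show ?case by (simp add: tok_conv_1)
next
  case (Suc j)
  then obtain n where "j = Suc n" by (cases j) auto
  then have "tok_conv c (\<lambda>_. a) (Suc j) = c * (a * (c ^ n - 1)) + (c - 1) * a"
    using Suc by (simp add: tok_conv_Suc)
  also have "\<dots> = a * (c ^ (Suc j - 1) - 1)"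
    using \<open>j = Suc n\<close> by (simp add: algebra_simps)
  finally show ?case .
qed

lemma tok_conv_power_le:
  assumes "j \<ge> 1" "c \<ge> 1" "q > c"
  shows "tok_conv c (\<lambda>i. q ^ i) j \<le> (c - 1) / (q - c) * q ^ j"
  using assms(1)
proof (induction j rule: nat_induct_at_least)
  case base
  then show ?case using assms by (simp add: tok_conv_1)
next
  case (Suc j)
  have "tok_conv c (\<lambda>i. q ^ i) (Suc j) \<le> c * ((c - 1) / (q - c) * q ^ j) + (c - 1) * q ^ j"
    using mult_left_mono[OF Suc.IH, of c] assms Suc.hyps by (simp only: tok_conv_Suc add_mono)
  also have "\<dots> = (c - 1) / (q - c) * q ^ Suc j"
    using assms by (simp add: field_simps)
  finally show ?case .
qed

text \<open>The subtrees of a branch multiply a variance of order \<open>q ^ j\<close> by at most \<open>2 / 3\<close>, so that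
  the noise created in one generation determines the growth of the variance. The bound is
  attained for \<open>c = 1\<close> and \<open>q = 3\<close>.\<close>

lemma tok_contraction:
  assumes j: "j \<ge> 2" and c: "c \<ge> 1" and q: "q \<ge> 3 * c\<^sup>2"
  shows "tok_conv c (\<lambda>i. q ^ i) j + 2 * q ^ (j - 1) \<le> 2 / 3 * q ^ j"
proof -
  have cc: "c \<le> c\<^sup>2" using c by (simp add: power2_eq_square)
  have q0: "q > c" "q > 0" "q - c \<ge> 2 * c\<^sup>2" using c q cc by auto
  have "(c - 1) / (q - c) \<le> (c - 1) / (2 * c\<^sup>2)"
    using c q0 by (intro divide_left_mono mult_pos_pos) auto
  moreover have "2 / q \<le> 2 / (3 * c\<^sup>2)"
    using c q q0 by (intro divide_left_mono mult_pos_pos) auto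
  moreover have "(c - 1) / (2 * c\<^sup>2) + 2 / (3 * c\<^sup>2) \<le> 2 / 3"
  proof -
    have "(c - 1) / (2 * c\<^sup>2) + 2 / (3 * c\<^sup>2) = (3 * c + 1) / (6 * c\<^sup>2)"
      using c by (simp add: field_simps)
    also have "\<dots> \<le> 4 * c\<^sup>2 / (6 * c\<^sup>2)"
      using c cc by (intro divide_right_mono) auto
    finally show ?thesis using c by simp
  qed
  ultimately have "(c - 1) / (q - c) + 2 / q \<le> 2 / 3" by linarith
  then have "((c - 1) / (q - c) + 2 / q) * q ^ j \<le> 2 / 3 * q ^ j"
    using q0 by (intro mult_right_mono) auto
  moreover have "2 / q * q ^ j = 2 * q ^ (j - 1)"
    using j q0 by (cases j) auto
  moreover have "tok_conv c (\<lambda>i. q ^ i) j \<le> (c - 1) / (q - c) * q ^ j"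
    by (rule tok_conv_power_le) (use j c q0 in auto)
  ultimately show ?thesis unfolding distrib_right by linarith
qed

text \<open>The recursion satisfied by the mean \<open>m j\<close> of the additive functional with weights \<open>w\<close> in a
  tree of order \<open>j\<close>; \<open>c ^ (j - 1) - 1\<close> is the expected number of side branches.\<close>

definition mean_rec :: "real \<Rightarrow> (nat \<Rightarrow> real) \<Rightarrow> (nat \<Rightarrow> real) \<Rightarrow> bool"
  where "mean_rec c w m \<longleftrightarrow> (\<forall>j\<ge>1. m j = w j + w j * (c ^ (j - 1) - 1) + tok_conv c m j
    + (if j \<ge> 2 then 2 * m (j - 1) else 0))"

lemma mean_rec_add:
  assumes "mean_rec c w m" "mean_rec c w' m'"
  shows "mean_rec c (\<lambda>j. w j + a * w' j) (\<lambda>j. m j + a * m' j)"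
proof -
  have "tok_conv c (\<lambda>j. m j + a * m' j) j = tok_conv c m j + a * tok_conv c m' j" for j
    by (simp add: tok_conv_def sum.distrib sum_distrib_left algebra_simps)
  then have "m j + a * m' j = (w j + a * w' j) + (w j + a * w' j) * (c ^ (j - 1) - 1) +
      tok_conv c (\<lambda>j. m j + a * m' j) j + (if j \<ge> 2 then 2 * (m (j - 1) + a * m' (j - 1)) else 0)"
    if "j \<ge> 1" for j
    using assms[unfolded mean_rec_def, rule_format, OF that] by (simp add: algebra_simps)
  then show ?thesis by (simp add: mean_rec_def)
qed

text \<open>The expected number of vertices of order \<open>k\<close> in a tree of order \<open>j\<close>: a branch of order \<open>k\<close> carries
  \<open>c ^ (k - 1)\<close> vertices on average, and the other factor is the expected number of such branches, whose
  generating function is \<open>(1 - c * z) / ((1 - z) * (1 - 2 * c * z))\<close>.\<close>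

definition mean_count :: "real \<Rightarrow> nat \<Rightarrow> nat \<Rightarrow> real"
  where "mean_count c k j = (if j < k then 0
    else c ^ (k - 1) * (c / (2 * c - 1) * (2 * c) ^ (j - k) + (c - 1) / (2 * c - 1)))"

lemma mean_count_diag:
  assumes "c \<ge> 1"
  shows "mean_count c k k = c ^ (k - 1)"
proof -
  have "c / (2 * c - 1) + (c - 1) / (2 * c - 1) = (2 * c - 1) / (2 * c - 1)"
    by (simp flip: add_divide_distrib)
  then show ?thesis using assms by (simp add: mean_count_def)
qed

lemma mean_count_next:
  assumes "c \<ge> 1"
  shows "mean_count c k (Suc k) = c ^ (k - 1) * (c + 1)"
proof -
  have "c / (2 * c - 1) * (2 * c) + (c - 1) / (2 * c - 1) = ((c + 1) * (2 * c - 1)) / (2 * c - 1)"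
    by (simp add: algebra_simps flip: add_divide_distrib)
  then show ?thesis using assms by (simp add: mean_count_def)
qed

text \<open>The numbers 1 and \<open>2 * c\<close> are the characteristic roots.\<close>

lemma mean_count_step:
  assumes "j \<ge> k"
  shows "mean_count c k (Suc (Suc j)) = (2 * c + 1) * mean_count c k (Suc j) - 2 * c * mean_count c k j"
proof -
  define A B p where "A = c / (2 * c - 1)" and "B = (c - 1) / (2 * c - 1)" and "p = c ^ (k - 1)"
  have "mean_count c k (k + n) = p * (A * (2 * c) ^ n + B)" for n
    by (simp add: mean_count_def A_def B_def p_def)
  from this[of "j - k"] this[of "Suc (j - k)"] this[of "Suc (Suc (j - k))"] show ?thesis
    using assms by (simp add: algebra_simps)
qed

lemma tok_conv_mean_count_le:
  assumes "1 \<le> j" "j \<le> k"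
  shows "tok_conv c (mean_count c k) j = 0"
  unfolding tok_conv_def by (rule sum.neutral) (use assms in \<open>auto simp: mean_count_def\<close>)

lemma tok_conv_mean_count:
  assumes c: "c \<ge> 1" and k: "k \<ge> 1" and j: "j \<ge> k"
  shows "tok_conv c (mean_count c k) (Suc j) = mean_count c k (Suc j) - 2 * mean_count c k j"
  using j
proof (induction j rule: nat_induct_at_least)
  case base
  show ?case
    using k c by (simp add: tok_conv_Suc tok_conv_mean_count_le mean_count_diag mean_count_next algebra_simps)
next
  case (Suc j)
  have "tok_conv c (mean_count c k) (Suc (Suc j)) =
      c * (mean_count c k (Suc j) - 2 * mean_count c k j) + (c - 1) * mean_count c k (Suc j)"
    using Suc k by (subst tok_conv_Suc) auto
  also have "\<dots> = mean_count c k (Suc (Suc j)) - 2 * mean_count c k (Suc j)"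
    using mean_count_step[OF Suc.hyps] by (simp add: algebra_simps)
  finally show ?case .
qed

lemma mean_rec_count:
  assumes c: "c \<ge> 1" and k: "k \<ge> 1"
  shows "mean_rec c (\<lambda>j. of_bool (j = k)) (mean_count c k)"
  unfolding mean_rec_def
proof (intro allI impI)
  fix j :: nat assume j: "j \<ge> 1"
  consider "j < k" | "j = k" | "j > k" by linarith
  then show "mean_count c k j = of_bool (j = k) + of_bool (j = k) * (c ^ (j - 1) - 1) +
      tok_conv c (mean_count c k) j + (if j \<ge> 2 then 2 * mean_count c k (j - 1) else 0)"
  proof cases
    case 1
    then have "j - 1 < k" by simp
    with 1 show ?thesis using j by (simp add: tok_conv_mean_count_le mean_count_def)
  next
    case 2
    then have "mean_count c k (j - 1) = 0" using j by (simp add: mean_count_def)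
    then show ?thesis using 2 j c by (simp add: tok_conv_mean_count_le mean_count_diag)
  next
    case 3
    then obtain n where "j = Suc n" "n \<ge> k" by (cases j) auto
    then show ?thesis using tok_conv_mean_count[OF c k, of n] k by simp
  qed
qed

section \<open>The critical Tokunaga process\<close>

locale tokunaga =
  fixes c \<gamma> :: real
  assumes rate_pos: "\<gamma> > 0" and c_ge_1: "c \<ge> 1"
begin

definition subtree :: "nat \<Rightarrow> descent list \<Rightarrow> (clock \<Rightarrow> real) \<Rightarrow> rtree"
  where "subtree j u \<omega> = branch_shape (tokunaga_coeff c) (tokunaga_rate c \<gamma>) \<omega> j u"

lemma measurable_subtree [measurable]: "subtree j u \<in> clock_measure \<rightarrow>\<^sub>M count_space UNIV"
  unfolding subtree_def by measurable

text \<open>Iterating one generation: if the fluctuation created in a generation is \<open>O(q ^ j)\<close>, so is the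
  variance.\<close>

lemma moments_le_subtree:
  assumes m: "mean_rec c w m"
    and b: "\<And>i j. 1 \<le> i \<Longrightarrow> i < j \<Longrightarrow> \<bar>w j + m i\<bar> \<le> b i"
    and H: "\<And>j. j \<ge> 1 \<Longrightarrow> 2 * (tok_conv c b j + (\<Sum>i=1..<j. b i))\<^sup>2 \<le> H * q ^ j"
    and q: "q \<ge> 3 * c\<^sup>2"
    and j: "j \<ge> 1"
  shows "clocks.moments_le (\<lambda>\<omega>. order_sum w (subtree j u \<omega>)) (m j) (3 * H * q ^ j)"
  using j
proof (induction j arbitrary: u rule: less_induct)
  case (less j)
  have coeff: "tokunaga_coeff c k \<ge> 0" for k
    using c_ge_1 by (simp add: tokunaga_coeff_def)
  have rate: "tokunaga_rate c \<gamma> j > 0"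
    using c_ge_1 rate_pos by (simp add: tokunaga_rate_def)
  have q0: "q > 0" using q c_ge_1 zero_less_power[of c 2] by linarith
  have H0: "H \<ge> 0"
  proof -
    have "0 \<le> 2 * (tok_conv c b 1 + (\<Sum>i=1..<1. b i))\<^sup>2" by simp
    also have "\<dots> \<le> H * q ^ 1" by (rule H) simp
    finally show ?thesis using q0 by (simp add: zero_le_mult_iff)
  qed
  let ?v = "\<lambda>i. 3 * H * q ^ i"
  have "clocks.moments_le (\<lambda>\<omega>. order_sum w (subtree j u \<omega>))
    (w j + (\<Sum>i=1..<j. tokunaga_coeff c (j - i) * (w j + m i)) + (if j \<ge> 2 then 2 * m (j - 1) else 0))
    (2 * (\<Sum>i=1..<j. (tokunaga_coeff c (j - i) + 1) * b i)\<^sup>2 +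
      ((\<Sum>i=1..<j. tokunaga_coeff c (j - i) * ?v i) + (if j \<ge> 2 then 2 * ?v (j - 1) else 0)))"
    unfolding subtree_def
    by (rule moments_le_branch[OF less.prems coeff rate less.IH[unfolded subtree_def] b])
  note mom = this
  have mean: "w j + (\<Sum>i=1..<j. tokunaga_coeff c (j - i) * (w j + m i)) +
      (if j \<ge> 2 then 2 * m (j - 1) else 0) = m j"
  proof -
    have "(\<Sum>i=1..<j. tokunaga_coeff c (j - i) * (w j + m i)) = tok_conv c (\<lambda>_. w j) j + tok_conv c m j"
      by (simp add: tok_conv_def distrib_left sum.distrib)
    then show ?thesis
      using m[unfolded mean_rec_def, rule_format, OF less.prems] tok_conv_const[OF less.prems, of c "w j"]
      by linarith
  qed
  have "2 * (\<Sum>i=1..<j. (tokunaga_coeff c (j - i) + 1) * b i)\<^sup>2 +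
      ((\<Sum>i=1..<j. tokunaga_coeff c (j - i) * ?v i) + (if j \<ge> 2 then 2 * ?v (j - 1) else 0)) \<le> ?v j"
  proof -
    have "2 * (\<Sum>i=1..<j. (tokunaga_coeff c (j - i) + 1) * b i)\<^sup>2 \<le> H * q ^ j"
      using H[OF less.prems] by (simp add: tok_conv_def distrib_right sum.distrib)
    moreover have "(\<Sum>i=1..<j. tokunaga_coeff c (j - i) * ?v i) + (if j \<ge> 2 then 2 * ?v (j - 1) else 0)
        \<le> 2 * H * q ^ j"
    proof (cases "j \<ge> 2")
      case True
      have "(\<Sum>i=1..<j. tokunaga_coeff c (j - i) * ?v i) + 2 * ?v (j - 1) =
          3 * H * (tok_conv c (\<lambda>i. q ^ i) j + 2 * q ^ (j - 1))"
        by (simp add: tok_conv_def sum_distrib_left algebra_simps)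
      also have "\<dots> \<le> 3 * H * (2 / 3 * q ^ j)"
        using H0 by (intro mult_left_mono tok_contraction True c_ge_1 q) auto
      finally show ?thesis using True by simp
    next
      case False
      then have "j = 1" using less.prems by simp
      then show ?thesis using H0 q0 by simp
    qed
    ultimately show ?thesis by simp
  qed
  then show ?case
    by (rule clocks.moments_le_mono[OF mom[unfolded mean]])
qed

end

section \<open>The number of leaves and its lower tail\<close>

lemma order_sum_nonneg: "(\<And>j. w j \<ge> 0) \<Longrightarrow> order_sum w t \<ge> 0"
proof -
  assume "\<And>j. w j \<ge> 0"
  then have "0 \<le> (\<Sum>v\<in>#N. w (vertex_order v))" for N
    by (induction N) auto
  then show ?thesis unfolding order_sum_def .
qed

lemma order_sum_linear:
  "order_sum (\<lambda>j. w j + a * w' j) t = order_sum w t + a * order_sum w' t"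
proof -
  have "(\<Sum>v\<in>#N. w (vertex_order v) + a * w' (vertex_order v)) =
      (\<Sum>v\<in>#N. w (vertex_order v)) + a * (\<Sum>v\<in>#N. w' (vertex_order v))" for N
    by (induction N) (auto simp: algebra_simps)
  then show ?thesis by (simp only: order_sum_def)
qed

lemma order_sum_of_bool:
  "order_sum (\<lambda>j. of_bool (j = k)) t = real (num_vertices k (Vertex {#t#}))"
proof -
  have "(\<Sum>v\<in>#N. of_bool (vertex_order v = k)) = real (size {#v \<in># N. vertex_order v = k#})" for N
    by (induction N) auto
  then show ?thesis by (simp add: order_sum_def num_vertices_def)
qed

lemma num_vertices_le_size: "num_vertices k t \<le> size (nonroot_vertices t)"
  unfolding num_vertices_def by (rule size_filter_mset_lesseq)

text \<open>A binary tree with \<open>n\<close> leaves has \<open>2 * n - 1\<close> non-root vertices, so the fraction of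
  vertices of order \<open>k\<close> is a function of two vertex counts.\<close>

lemma size_nonroot_vertices:
  assumes "strahler t j"
  shows "real (size (nonroot_vertices (Vertex {#t#}))) = 2 * real (num_vertices 1 (Vertex {#t#})) - 1"
  using assms
proof (induction rule: strahler.induct)
  case leaf
  then show ?case
    using vertex_order_strahler[OF strahler.leaf] by (simp add: num_vertices_def)
next
  case (fork a i b j)
  have "vertex_order (Vertex {#a, b#}) \<noteq> 1"
    using vertex_order_strahler[OF strahler.fork[OF fork.hyps(1,2)]]
      strahler_pos[OF fork.hyps(1)] strahler_pos[OF fork.hyps(2)] by auto
  then have "num_vertices 1 (Vertex {#Vertex {#a, b#}#}) =
      num_vertices 1 (Vertex {#a#}) + num_vertices 1 (Vertex {#b#})"
    by (simp add: num_vertices_def)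
  then show ?case using fork.IH by simp
qed

lemma num_leaves_pos:
  assumes "strahler t j"
  shows "num_vertices 1 (Vertex {#t#}) \<ge> 1"
proof -
  have "real (size (nonroot_vertices (Vertex {#t#}))) \<ge> 1" by simp
  then have "2 * real (num_vertices 1 (Vertex {#t#})) - 1 \<ge> 1"
    unfolding size_nonroot_vertices[OF assms] .
  then show ?thesis by linarith
qed

lemma exp_minus_le:
  fixes x :: real
  assumes "x \<ge> 0"
  shows "exp (- x) \<le> 1 - x + x\<^sup>2 / 2"
proof -
  have "(\<lambda>y. 1 - y + y\<^sup>2 / 2 - exp (- y)) 0 \<le> (\<lambda>y. 1 - y + y\<^sup>2 / 2 - exp (- y)) x"
  proof (rule DERIV_nonneg_imp_nondecreasing[OF assms])
    fix y :: real
    have "((\<lambda>y. 1 - y + y\<^sup>2 / 2 - exp (- y)) has_real_derivative - 1 + y + exp (- y)) (at y)"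
      by (auto intro!: derivative_eq_intros)
    moreover have "- 1 + y + exp (- y) \<ge> 0"
      using exp_ge_add_one_self[of "- y"] by simp
    ultimately show "\<exists>z. ((\<lambda>y. 1 - y + y\<^sup>2 / 2 - exp (- y)) has_real_derivative z) (at y) \<and> 0 \<le> z"
      by blast
  qed
  then show ?thesis by simp
qed

lemma double_power_square:
  fixes c :: real
  shows "((2 * c) ^ j)\<^sup>2 = (4 * c\<^sup>2) ^ j"
proof -
  have "((2 * c) ^ j)\<^sup>2 = ((2 * c)\<^sup>2) ^ j" by (simp only: mult.commute flip: power_mult)
  then show ?thesis by (simp only: power_mult_distrib) simp
qed

lemma Suc_square_le: "(real j + 1)\<^sup>2 \<le> 4 * 3 ^ j"
proof (induction j)
  case 0
  then show ?case by simp
next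
  case (Suc j)
  show ?case
  proof (cases j)
    case 0
    then show ?thesis by (simp add: power2_eq_square)
  next
    case (Suc n)
    have "(real (Suc j) + 1)\<^sup>2 \<le> 3 * (real j + 1)\<^sup>2"
      using Suc by (simp add: power2_eq_square algebra_simps)
    also have "\<dots> \<le> 3 * (4 * 3 ^ j)" using Suc.IH by simp
    finally show ?thesis by simp
  qed
qed

context tokunaga
begin

definition leaves :: "nat \<Rightarrow> descent list \<Rightarrow> (clock \<Rightarrow> real) \<Rightarrow> real"
  where "leaves j u \<omega> = order_sum (\<lambda>i. of_bool (i = 1)) (subtree j u \<omega>)"

lemma measurable_leaves [measurable]: "leaves j u \<in> borel_measurable clock_measure"
  unfolding leaves_def by (rule measurable_compose[OF measurable_subtree]) simp

lemma mean_count_1_bounds: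
  assumes "i \<ge> 1"
  shows "(2 * c) ^ (i - 1) / 2 \<le> mean_count c 1 i" "mean_count c 1 i \<le> (2 * c) ^ (i - 1)"
proof -
  let ?x = "(2 * c) ^ (i - 1)"
  have x: "?x \<ge> 1" using c_ge_1 by (intro one_le_power) simp
  have m: "mean_count c 1 i = c / (2 * c - 1) * ?x + (c - 1) / (2 * c - 1)"
    using assms by (simp add: mean_count_def)
  have B: "(c - 1) / (2 * c - 1) \<ge> 0" using c_ge_1 by simp
  have "1 / 2 \<le> c / (2 * c - 1)" using c_ge_1 by (simp add: field_simps)
  then have "1 / 2 * ?x \<le> c / (2 * c - 1) * ?x" using x by (intro mult_right_mono) auto
  then show "?x / 2 \<le> mean_count c 1 i" using B unfolding m by linarith
  have "c / (2 * c - 1) + (c - 1) / (2 * c - 1) = (2 * c - 1) / (2 * c - 1)"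
    by (simp flip: add_divide_distrib)
  then have AB: "c / (2 * c - 1) + (c - 1) / (2 * c - 1) = 1" using c_ge_1 by simp
  have "(c - 1) / (2 * c - 1) * 1 \<le> (c - 1) / (2 * c - 1) * ?x"
    using B x by (intro mult_left_mono) auto
  then have "mean_count c 1 i \<le> (c / (2 * c - 1) + (c - 1) / (2 * c - 1)) * ?x"
    unfolding m distrib_right by linarith
  then show "mean_count c 1 i \<le> ?x" unfolding AB by simp
qed

text \<open>The standard deviation of the number of leaves is at most of the order of its mean. This is
  what keeps the number of leaves away from 0 on the scale of its mean with positive probability.\<close>

lemma moments_le_leaves:
  assumes "j \<ge> 1"
  shows "clocks.moments_le (leaves j u) (mean_count c 1 j) (24 * (4 * c\<^sup>2) ^ j)"
proof -
  have "clocks.moments_le (leaves j u) (mean_count c 1 j) (3 * 8 * (4 * c\<^sup>2) ^ j)"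
    unfolding leaves_def
  proof (rule moments_le_subtree[OF mean_rec_count, where b="\<lambda>i. (2 * c) ^ i"])
    show "\<bar>of_bool (j = 1) + mean_count c 1 i\<bar> \<le> (2 * c) ^ i" if "1 \<le> i" "i < j" for i j
    proof -
      have "(2 * c) ^ (i - 1) \<le> (2 * c) ^ i" using c_ge_1 by (intro power_increasing) auto
      moreover have "(2 * c) ^ (i - 1) \<ge> 0" using c_ge_1 by simp
      ultimately show ?thesis using mean_count_1_bounds[of i] that by simp
    qed
    show "2 * (tok_conv c ((^) (2 * c)) j + (\<Sum>i=1..<j. (2 * c) ^ i))\<^sup>2 \<le> 8 * (4 * c\<^sup>2) ^ j"
      if j: "j \<ge> 1" for j
    proof -
      have "tok_conv c ((^) (2 * c)) j \<le> (c - 1) / (2 * c - c) * (2 * c) ^ j"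
        by (rule tok_conv_power_le) (use j c_ge_1 in auto)
      also have "\<dots> \<le> 1 * (2 * c) ^ j"
        using c_ge_1 by (intro mult_right_mono) auto
      finally have 1: "tok_conv c ((^) (2 * c)) j \<le> (2 * c) ^ j" by simp
      have 2: "(\<Sum>i=1..<j. (2 * c) ^ i) \<le> (2 * c) ^ j" using j
      proof (induction j rule: nat_induct_at_least)
        case base
        then show ?case using c_ge_1 by simp
      next
        case (Suc j)
        have "(\<Sum>i=1..<Suc j. (2 * c) ^ i) = (\<Sum>i=1..<j. (2 * c) ^ i) + (2 * c) ^ j"
          using Suc.hyps by simp
        also have "\<dots> \<le> 2 * (2 * c) ^ j" using Suc.IH by linarith
        also have "\<dots> \<le> (2 * c) * (2 * c) ^ j" using c_ge_1 by (intro mult_right_mono) auto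
        finally show ?case by simp
      qed
      have "tok_conv c ((^) (2 * c)) j \<ge> 0" "(\<Sum>i=1..<j. (2 * c) ^ i) \<ge> 0"
        using c_ge_1 by (auto simp: tok_conv_def tokunaga_coeff_def intro!: sum_nonneg)
      with 1 2 have "(tok_conv c ((^) (2 * c)) j + (\<Sum>i=1..<j. (2 * c) ^ i))\<^sup>2 \<le> (2 * (2 * c) ^ j)\<^sup>2"
        by (intro power_mono) auto
      also have "\<dots> = 4 * (4 * c\<^sup>2) ^ j"
        unfolding power_mult_distrib[of 2 "(2 * c) ^ j"] double_power_square by simp
      finally show ?thesis by simp
    qed
  qed (use assms c_ge_1 in auto)
  then show ?thesis by simp
qed

lemma leaves_nonneg: "leaves j u \<omega> \<ge> 0"
  unfolding leaves_def by (rule order_sum_nonneg) simp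

lemma leaves_split: "leaves (Suc j) u \<omega> \<ge> leaves j (Split False # u) \<omega> + leaves j (Split True # u) \<omega>"
  if "j \<ge> 1"
proof -
  have "0 \<le> (\<Sum>(i, n)\<leftarrow>offspring (tokunaga_coeff c) (tokunaga_rate c \<gamma>) \<omega> (Suc j) u.
      of_bool (Suc j = 1) + leaves i (Side i n # u) \<omega>)"
    by (rule sum_list_nonneg) (use leaves_nonneg in auto)
  then show ?thesis
    using that order_sum_branch_shape[of "Suc j" "\<lambda>i. of_bool (i = 1)" "tokunaga_coeff c" "tokunaga_rate c \<gamma>" \<omega> u]
    by (simp add: leaves_def subtree_def)
qed

definition leaves_laplace :: "real \<Rightarrow> nat \<Rightarrow> descent list \<Rightarrow> real"
  where "leaves_laplace s j u = clocks.expectation (\<lambda>\<omega>. exp (- (s * leaves j u \<omega>)))"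

lemma integrable_leaves_laplace:
  assumes "s \<ge> 0"
  shows "integrable clock_measure (\<lambda>\<omega>. exp (- (s * leaves j u \<omega>)))"
proof (rule clocks.integrable_const_bound[where B=1])
  show "AE \<omega> in clock_measure. norm (exp (- (s * leaves j u \<omega>))) \<le> 1"
    using assms leaves_nonneg by (intro AE_I2) simp
qed measurable

lemma leaves_laplace_nonneg: "leaves_laplace s j u \<ge> 0"
  unfolding leaves_laplace_def by (rule Bochner_Integration.integral_nonneg) simp

text \<open>A tree of order \<open>Suc j\<close> has at least the leaves of the two independent trees of order \<open>j\<close>
  in which its root branch ends.\<close>

lemma leaves_laplace_split:
  assumes "j \<ge> 1" "s \<ge> 0"
  shows "leaves_laplace s (Suc j) u \<le> leaves_laplace s j (Split False # u) * leaves_laplace s j (Split True # u)"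
proof -
  let ?f = "\<lambda>d \<omega>. exp (- (s * leaves j (d # u) \<omega>))"
  have ind: "clocks.indep_vars (\<lambda>_. borel) ?f {Split False, Split True}"
    unfolding leaves_def subtree_def
    by (rule clocks.indep_vars_compose2[OF clocks.indep_vars_subset[OF indep_subtrees[where f="\<lambda>_. j"]]]) auto
  have "leaves_laplace s (Suc j) u \<le> clocks.expectation (\<lambda>\<omega>. \<Prod>d\<in>{Split False, Split True}. ?f d \<omega>)"
    unfolding leaves_laplace_def
  proof (rule integral_mono)
    show "integrable clock_measure (\<lambda>\<omega>. exp (- (s * leaves (Suc j) u \<omega>)))"
      by (rule integrable_leaves_laplace[OF assms(2)])
    show "integrable clock_measure (\<lambda>\<omega>. \<Prod>d\<in>{Split False, Split True}. ?f d \<omega>)"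
      by (rule clocks.indep_vars_integrable[OF _ ind]) (auto intro: integrable_leaves_laplace[OF assms(2)])
    show "exp (- (s * leaves (Suc j) u \<omega>)) \<le> (\<Prod>d\<in>{Split False, Split True}. ?f d \<omega>)" for \<omega>
      using mult_left_mono[OF leaves_split[OF assms(1)] assms(2), of u \<omega>]
      by (simp add: exp_add[symmetric] distrib_left)
  qed
  also have "\<dots> = (\<Prod>d\<in>{Split False, Split True}. clocks.expectation (?f d))"
    by (rule clocks.indep_vars_lebesgue_integral[OF _ ind]) (auto intro: integrable_leaves_laplace[OF assms(2)])
  also have "\<dots> = leaves_laplace s j (Split False # u) * leaves_laplace s j (Split True # u)"
    by (simp add: leaves_laplace_def)
  finally show ?thesis .
qed

lemma leaves_laplace_iterate:
  assumes "j \<ge> 1" "s \<ge> 0" "\<And>u. leaves_laplace s j u \<le> r"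
  shows "leaves_laplace s (j + m) u \<le> r ^ (2 ^ m)"
proof (induction m arbitrary: u)
  case 0
  then show ?case using assms by simp
next
  case (Suc m)
  have "leaves_laplace s (j + Suc m) u \<le>
      leaves_laplace s (j + m) (Split False # u) * leaves_laplace s (j + m) (Split True # u)"
    using leaves_laplace_split[of "j + m" s u] assms by simp
  also have "\<dots> \<le> r ^ (2 ^ m) * r ^ (2 ^ m)"
    using Suc.IH order_trans[OF leaves_laplace_nonneg Suc.IH] leaves_laplace_nonneg
    by (intro mult_mono) auto
  also have "\<dots> = r ^ (2 ^ Suc m)"
    by (simp add: mult_2 flip: power_add)
  finally show ?case .
qed

text \<open>The values of \<open>\<epsilon>\<close> and \<open>1 - \<epsilon> / (4 * c) + 25 / 2 * \<epsilon>\<^sup>2\<close> for \<open>\<epsilon> = 1 / (100 * c)\<close>, the minimizer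
  of this quadratic, which appears as a bound in the next lemma.\<close>

definition tail_scale :: real
  where "tail_scale = 1 / (100 * c)"

definition tail_rate :: real
  where "tail_rate = 1 - 1 / (800 * c\<^sup>2)"

text \<open>Insert the first two moments into \<open>exp (- x) \<le> 1 - x + x\<^sup>2 / 2\<close>. By \<open>moments_le_leaves\<close> the
  second moment of the number of leaves is at most \<open>25 * (2 * c) ^ (2 * j)\<close>, and the mean is at least
  \<open>(2 * c) ^ j / (4 * c)\<close>.\<close>

lemma leaves_laplace_base:
  assumes "j \<ge> 1"
  shows "leaves_laplace (tail_scale / (2 * c) ^ j) j u \<le> tail_rate"
proof -
  let ?V = "leaves j u" and ?m = "mean_count c 1 j" and ?x = "(2 * c) ^ j"
  define s where "s = tail_scale / ?x"
  have x: "?x > 0" "?x * ?x = (4 * c\<^sup>2) ^ j"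
    using c_ge_1 double_power_square[of c j] by (simp_all only: power2_eq_square) simp
  have s: "s \<ge> 0" using c_ge_1 by (simp add: s_def tail_scale_def)
  have mom: "integrable clock_measure ?V" "clocks.expectation ?V = ?m"
    "integrable clock_measure (\<lambda>\<omega>. (?V \<omega> - ?m)\<^sup>2)"
    "clocks.expectation (\<lambda>\<omega>. (?V \<omega> - ?m)\<^sup>2) \<le> 24 * (?x * ?x)"
    using moments_le_leaves[OF assms, of u] unfolding clocks.moments_le_def x by auto
  have m: "?x / (4 * c) \<le> ?m" "0 \<le> ?m" "?m \<le> ?x"
  proof -
    have "?x = 2 * c * (2 * c) ^ (j - 1)" using assms by (cases j) auto
    then have "?x / (4 * c) = (2 * c) ^ (j - 1) / 2" using c_ge_1 by simp
    then show 1: "?x / (4 * c) \<le> ?m" using mean_count_1_bounds(1)[OF assms] by linarith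
    have "0 \<le> ?x / (4 * c)" using x c_ge_1 by simp
    with 1 show "0 \<le> ?m" by linarith
    have "(2 * c) ^ (j - 1) \<le> ?x" using c_ge_1 by (intro power_increasing) auto
    then show "?m \<le> ?x" using mean_count_1_bounds[OF assms] by simp
  qed
  have sq: "(?V \<omega>)\<^sup>2 = (?V \<omega> - ?m)\<^sup>2 + 2 * ?m * ?V \<omega> - ?m\<^sup>2" for \<omega>
    by (simp add: power2_eq_square algebra_simps)
  have isq: "integrable clock_measure (\<lambda>\<omega>. (?V \<omega>)\<^sup>2)"
    unfolding sq using mom by simp
  have "clocks.expectation (\<lambda>\<omega>. (?V \<omega>)\<^sup>2) = clocks.expectation (\<lambda>\<omega>. (?V \<omega> - ?m)\<^sup>2) + ?m\<^sup>2"
    unfolding sq using mom clocks.prob_space[unfolded space_clock_measure]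
    by (simp add: power2_eq_square)
  moreover have "?m\<^sup>2 \<le> ?x * ?x"
    unfolding power2_eq_square by (rule mult_mono) (use m x in linarith)+
  ultimately have E2: "clocks.expectation (\<lambda>\<omega>. (?V \<omega>)\<^sup>2) \<le> 25 * (?x * ?x)"
    using mom(4) by linarith
  have "leaves_laplace s j u \<le> clocks.expectation (\<lambda>\<omega>. 1 - s * ?V \<omega> + s\<^sup>2 / 2 * (?V \<omega>)\<^sup>2)"
    unfolding leaves_laplace_def
  proof (rule integral_mono[OF integrable_leaves_laplace[OF s]])
    show "integrable clock_measure (\<lambda>\<omega>. 1 - s * ?V \<omega> + s\<^sup>2 / 2 * (?V \<omega>)\<^sup>2)"
      using mom isq by auto
    show "exp (- (s * ?V \<omega>)) \<le> 1 - s * ?V \<omega> + s\<^sup>2 / 2 * (?V \<omega>)\<^sup>2" for \<omega>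
      using exp_minus_le[of "s * ?V \<omega>"] s leaves_nonneg[of j u \<omega>] by (simp add: power_mult_distrib)
  qed
  also have "\<dots> = 1 - s * ?m + s\<^sup>2 / 2 * clocks.expectation (\<lambda>\<omega>. (?V \<omega>)\<^sup>2)"
    using mom isq clocks.prob_space[unfolded space_clock_measure] by simp
  also have "\<dots> \<le> 1 - s * (?x / (4 * c)) + s\<^sup>2 / 2 * (25 * (?x * ?x))"
    using s m E2 by (intro add_mono diff_mono mult_left_mono) auto
  also have "\<dots> = tail_rate"
  proof -
    have "s * ?x = tail_scale" unfolding s_def using x(1) by (metis less_irrefl nonzero_eq_divide_eq)
    moreover have "s * (?x / (4 * c)) = (s * ?x) / (4 * c)" by (rule times_divide_eq_right)
    moreover have "s\<^sup>2 / 2 * (25 * (?x * ?x)) = 25 / 2 * (s * ?x)\<^sup>2"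
      by (simp only: power2_eq_square) algebra
    ultimately have "1 - s * (?x / (4 * c)) + s\<^sup>2 / 2 * (25 * (?x * ?x)) =
        1 - tail_scale / (4 * c) + 25 / 2 * tail_scale\<^sup>2" by (simp only:)
    also have "\<dots> = tail_rate"
      using c_ge_1 by (simp add: tail_scale_def tail_rate_def power2_eq_square field_simps)
    finally show ?thesis .
  qed
  finally show ?thesis unfolding s_def .
qed

text \<open>A tree of order \<open>K\<close> contains \<open>2 ^ m\<close> independent trees of order \<open>K - m\<close>, and it is unlikely
  that all of them have far fewer leaves than \<open>(2 * c) ^ (K - m)\<close>.\<close>

lemma leaves_lower_tail:
  assumes "m < K"
  shows "leaves_laplace (tail_scale / (2 * c) ^ (K - m)) K u \<le> tail_rate ^ (2 ^ m)"
  using leaves_laplace_iterate[of "K - m" "tail_scale / (2 * c) ^ (K - m)" tail_rate m u]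
    leaves_laplace_base[of "K - m"] assms c_ge_1
  by (simp add: tail_scale_def)

section \<open>Concentration of the vertex counts\<close>

text \<open>The deviation of the number of vertices of order \<open>k\<close> from the share of the number of leaves
  that it should asymptotically have.\<close>

definition imbalance :: "nat \<Rightarrow> nat \<Rightarrow> descent list \<Rightarrow> (clock \<Rightarrow> real) \<Rightarrow> real"
  where "imbalance k j u \<omega> =
    order_sum (\<lambda>i. of_bool (i = k) + (- ((1 / 2) ^ (k - 1))) * of_bool (i = 1)) (subtree j u \<omega>)"

definition mean_imbalance :: "nat \<Rightarrow> nat \<Rightarrow> real"
  where "mean_imbalance k j = mean_count c k j + (- ((1 / 2) ^ (k - 1))) * mean_count c 1 j"

text \<open>The growing parts of the two means cancel.\<close>

lemma mean_imbalance_const: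
  assumes "k \<ge> 1" "j \<ge> k"
  shows "mean_imbalance k j = (c - 1) / (2 * c - 1) * (c ^ (k - 1) - (1 / 2) ^ (k - 1))"
proof -
  have "j - 1 = (j - k) + (k - 1)" using assms by simp
  then have "(1 / 2) ^ (k - 1) * (2 * c) ^ (j - 1) = (1 / 2) ^ (k - 1) * ((2 * c) ^ (j - k) * (2 * c) ^ (k - 1))"
    by (simp only: power_add)
  also have "\<dots> = (1 / 2 * (2 * c)) ^ (k - 1) * (2 * c) ^ (j - k)"
    unfolding power_mult_distrib[of "1 / 2"] by (simp only: mult_ac)
  also have "1 / 2 * (2 * c) = c" by simp
  finally have e: "(1 / 2) ^ (k - 1) * (2 * c) ^ (j - 1) = c ^ (k - 1) * (2 * c) ^ (j - k)" .
  have gen: "q * (A * X + B) + (- p) * (A * Y + B) = B * (q - p)" if "p * Y = q * X"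
    for A B X Y p q :: real
  proof -
    have "q * (A * X + B) + (- p) * (A * Y + B) = A * (q * X) - A * (p * Y) + B * (q - p)"
      by (simp add: algebra_simps)
    then show ?thesis using that by simp
  qed
  have mk: "mean_count c k j = c ^ (k - 1) * (c / (2 * c - 1) * (2 * c) ^ (j - k) + (c - 1) / (2 * c - 1))"
    and m1: "mean_count c 1 j = c / (2 * c - 1) * (2 * c) ^ (j - 1) + (c - 1) / (2 * c - 1)"
    using assms by (auto simp: mean_count_def)
  show ?thesis unfolding mean_imbalance_def mk m1 by (rule gen[OF e])
qed

lemma mean_imbalance_bounded:
  assumes "k \<ge> 1"
  obtains B where "B \<ge> 0" "\<And>j. \<bar>mean_imbalance k j\<bar> \<le> B"
proof
  let ?B = "(\<Sum>i<k. \<bar>mean_imbalance k i\<bar>) + \<bar>mean_imbalance k k\<bar>"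
  have s: "(\<Sum>i<k. \<bar>mean_imbalance k i\<bar>) \<ge> 0" by (rule sum_nonneg) simp
  then show "?B \<ge> 0" by simp
  show "\<bar>mean_imbalance k j\<bar> \<le> ?B" for j
  proof (cases "j < k")
    case True
    then have "\<bar>mean_imbalance k j\<bar> \<le> (\<Sum>i<k. \<bar>mean_imbalance k i\<bar>)"
      by (intro member_le_sum) auto
    then show ?thesis by simp
  next
    case False
    then show ?thesis using mean_imbalance_const[OF assms] s by simp
  qed
qed

text \<open>With bounded means, the offspring of one generation contribute a fluctuation of the size
  \<open>j\<^sup>2 * c ^ (2 * j)\<close> only. The variance of the imbalance therefore grows like \<open>(3 * c\<^sup>2) ^ j\<close> at
  most, slower than the square \<open>(4 * c\<^sup>2) ^ j\<close> of the expected number of leaves.\<close>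

lemma moments_le_imbalance:
  assumes k: "k \<ge> 1"
  obtains H where "H \<ge> 0"
    "\<And>j u. j \<ge> 1 \<Longrightarrow> clocks.moments_le (imbalance k j u) (mean_imbalance k j) (H * (3 * c\<^sup>2) ^ j)"
proof -
  obtain B where B: "B \<ge> 0" "\<And>j. \<bar>mean_imbalance k j\<bar> \<le> B"
    using mean_imbalance_bounded[OF k] by blast
  let ?w = "\<lambda>i. of_bool (i = k) + (- ((1 / 2) ^ (k - 1))) * of_bool (i = 1) :: real"
  define b where "b = B + 2"
  have w: "\<bar>?w j\<bar> \<le> 2" for j
  proof -
    have "0 \<le> (1 / 2 :: real) ^ (k - 1)" "(1 / 2 :: real) ^ (k - 1) \<le> 1"
      by (auto intro: power_le_one)
    then show ?thesis by (cases "j = k"; cases "j = 1") auto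
  qed
  have rec: "mean_rec c ?w (mean_imbalance k)"
  proof -
    have "mean_imbalance k = (\<lambda>j. mean_count c k j + (- ((1 / 2) ^ (k - 1))) * mean_count c 1 j)"
      by (simp add: mean_imbalance_def fun_eq_iff)
    then show ?thesis
      by (simp only: mean_rec_add[OF mean_rec_count[OF c_ge_1 k] mean_rec_count[OF c_ge_1 order_refl]])
  qed
  have "clocks.moments_le (imbalance k j u) (mean_imbalance k j) (3 * (8 * b\<^sup>2) * (3 * c\<^sup>2) ^ j)"
    if j: "j \<ge> 1" for j u
    unfolding imbalance_def
  proof (rule moments_le_subtree[OF rec, where b="\<lambda>_. b"])
    show "\<bar>?w j + mean_imbalance k i\<bar> \<le> b" for i j
      using abs_triangle_ineq[of "?w j" "mean_imbalance k i"] w[of j] B(2)[of i]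
      unfolding b_def by linarith
    show "2 * (tok_conv c (\<lambda>_. b) j + (\<Sum>i=1..<j. b))\<^sup>2 \<le> 8 * b\<^sup>2 * (3 * c\<^sup>2) ^ j" if j: "j \<ge> 1" for j
    proof -
      have cj: "c ^ (j - 1) \<le> c ^ j" "1 \<le> c ^ j" "1 \<le> c ^ (j - 1)"
        using c_ge_1 by (auto intro: power_increasing one_le_power)
      have "real j * 1 \<le> real j * c ^ j" using cj by (intro mult_left_mono) auto
      then have 1: "c ^ (j - 1) - 1 + (real j - 1) \<le> (real j + 1) * c ^ j"
        using cj by (simp add: algebra_simps)
      have 0: "c ^ (j - 1) - 1 + (real j - 1) \<ge> 0" using cj j by simp
      have "tok_conv c (\<lambda>_. b) j + (\<Sum>i=1..<j. b) = b * (c ^ (j - 1) - 1 + (real j - 1))"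
        using j by (simp add: tok_conv_const of_nat_diff algebra_simps)
      then have "2 * (tok_conv c (\<lambda>_. b) j + (\<Sum>i=1..<j. b))\<^sup>2 =
          2 * b\<^sup>2 * (c ^ (j - 1) - 1 + (real j - 1))\<^sup>2"
        by (simp add: power_mult_distrib)
      also have "\<dots> \<le> 2 * b\<^sup>2 * ((real j + 1) * c ^ j)\<^sup>2"
        by (intro mult_left_mono power_mono 0 1) auto
      also have "\<dots> = 2 * b\<^sup>2 * ((real j + 1)\<^sup>2 * (c\<^sup>2) ^ j)"
        by (simp add: power_mult_distrib power2_eq_square)
      also have "\<dots> \<le> 2 * b\<^sup>2 * (4 * 3 ^ j * (c\<^sup>2) ^ j)"
        by (intro mult_left_mono mult_right_mono Suc_square_le) auto
      finally show ?thesis by (simp add: power_mult_distrib)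
    qed
  qed (use j in auto)
  then show ?thesis by (intro that[of "3 * (8 * b\<^sup>2)"]) auto
qed

lemma imbalance_eq:
  "imbalance k j u \<omega> = real (num_vertices k (Vertex {#subtree j u \<omega>#})) - (1 / 2) ^ (k - 1) * leaves j u \<omega>"
  unfolding imbalance_def leaves_def order_sum_linear order_sum_of_bool by simp

lemma expectation_num_vertices:
  assumes "k \<ge> 1" "j \<ge> 1"
  shows "clocks.expectation (\<lambda>\<omega>. real (num_vertices k (Vertex {#subtree j u \<omega>#}))) = mean_count c k j"
proof -
  obtain H where "clocks.moments_le (imbalance k j u) (mean_imbalance k j) (H * (3 * c\<^sup>2) ^ j)"
    using moments_le_imbalance[OF assms(1)] assms(2) by blast
  then have D: "integrable clock_measure (imbalance k j u)"
    "clocks.expectation (imbalance k j u) = mean_imbalance k j"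
    unfolding clocks.moments_le_def by auto
  have V: "integrable clock_measure (leaves j u)" "clocks.expectation (leaves j u) = mean_count c 1 j"
    using moments_le_leaves[OF assms(2), of u] unfolding clocks.moments_le_def by auto
  have "clocks.expectation (\<lambda>\<omega>. real (num_vertices k (Vertex {#subtree j u \<omega>#}))) =
      clocks.expectation (\<lambda>\<omega>. imbalance k j u \<omega> + (1 / 2) ^ (k - 1) * leaves j u \<omega>)"
    by (simp only: imbalance_eq) simp
  also have "\<dots> = mean_imbalance k j + (1 / 2) ^ (k - 1) * mean_count c 1 j"
    using D V by simp
  finally show ?thesis by (simp add: mean_imbalance_def)
qed

text \<open>The ratio differs from its limit by the bounded mean imbalance divided by the expected number
  of leaves.\<close>

lemma mean_ratio_limit:
  assumes k: "k \<ge> 1"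
  shows "(\<lambda>K. mean_count c k K / mean_count c 1 K) \<longlonglongrightarrow> (1 / 2) ^ (k - 1)"
proof -
  obtain B where B: "B \<ge> 0" "\<And>j. \<bar>mean_imbalance k j\<bar> \<le> B"
    using mean_imbalance_bounded[OF k] by blast
  have "(\<lambda>K. mean_count c k K / mean_count c 1 K - (1 / 2) ^ (k - 1)) \<longlonglongrightarrow> 0"
  proof (rule Lim_null_comparison)
    show "eventually (\<lambda>K. norm (mean_count c k K / mean_count c 1 K - (1 / 2) ^ (k - 1)) \<le> 4 * B * (1 / 2) ^ K) sequentially"
      using eventually_ge_at_top[of 1]
    proof eventually_elim
      case (elim K)
      have "(2::real) ^ (K - 1) \<le> (2 * c) ^ (K - 1)" using c_ge_1 by (intro power_mono) auto
      moreover have "(2::real) ^ K = 2 * 2 ^ (K - 1)" using elim by (cases K) auto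
      ultimately have m: "2 ^ K / 4 \<le> mean_count c 1 K"
        using mean_count_1_bounds(1)[OF elim] by linarith
      have pos: "(2 :: real) ^ K / 4 > 0" by simp
      then have m0: "mean_count c 1 K > 0" using m by linarith
      have "mean_count c k K / mean_count c 1 K - (1 / 2) ^ (k - 1) = mean_imbalance k K / mean_count c 1 K"
        using m0 by (simp add: mean_imbalance_def field_simps)
      then have "norm (mean_count c k K / mean_count c 1 K - (1 / 2) ^ (k - 1)) =
          \<bar>mean_imbalance k K\<bar> / mean_count c 1 K"
        using m0 by simp
      also have "\<dots> \<le> B / (2 ^ K / 4)"
        by (intro frac_le B m pos)
      finally show ?case by (simp add: power_one_over field_simps)
    qed
    show "(\<lambda>K. 4 * B * (1 / 2) ^ K) \<longlonglongrightarrow> 0"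
      by (intro tendsto_mult_right_zero LIMSEQ_power_zero) simp
  qed
  then show ?thesis by (simp add: LIM_zero_iff)
qed

definition order_fraction :: "nat \<Rightarrow> nat \<Rightarrow> (clock \<Rightarrow> real) \<Rightarrow> real"
  where "order_fraction k K \<omega> = real (num_vertices k (Vertex {#subtree K [] \<omega>#})) /
    real (size (nonroot_vertices (Vertex {#subtree K [] \<omega>#})))"

lemma order_fraction_bounds: "0 \<le> order_fraction k K \<omega>" "order_fraction k K \<omega> \<le> 1"
  unfolding order_fraction_def using num_vertices_le_size[of k "Vertex {#subtree K [] \<omega>#}"]
  by (auto simp: divide_le_eq_1)

text \<open>With \<open>V\<close> leaves the deviation is \<open>(D + (1 / 2) ^ k) / (2 * V - 1)\<close> for the imbalance \<open>D\<close>. If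
  \<open>s * V \<ge> 1\<close>, this is at most \<open>(\<bar>D\<bar> + 1) * s\<close>. Otherwise there are few leaves;
  then the exponential term exceeds 1, and the deviation does not.\<close>

lemma order_fraction_deviation:
  assumes k: "k \<ge> 1" and K: "K \<ge> 1" and s: "s \<ge> 0"
  shows "(order_fraction k K \<omega> - (1 / 2) ^ k)\<^sup>2 \<le>
    2 * s\<^sup>2 * ((imbalance k K [] \<omega>)\<^sup>2 + 1) + exp 1 * exp (- (s * leaves K [] \<omega>))"
proof -
  let ?t = "subtree K [] \<omega>" and ?p = "(1 / 2 :: real) ^ k"
  define V where "V = leaves K [] \<omega>"
  define D where "D = imbalance k K [] \<omega>"
  have st: "strahler ?t K" unfolding subtree_def by (rule strahler_branch_shape[OF K])
  have V: "V \<ge> 1" "real (size (nonroot_vertices (Vertex {#?t#}))) = 2 * V - 1"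
    using num_leaves_pos[OF st] size_nonroot_vertices[OF st] by (auto simp: V_def leaves_def order_sum_of_bool)
  have p: "0 \<le> ?p" "?p \<le> 1" "(1 / 2) ^ (k - 1) = 2 * ?p"
    using k by (auto simp: power_le_one) (cases k; simp)
  show ?thesis
  proof (cases "s * V \<ge> 1")
    case True
    have "real (num_vertices k (Vertex {#?t#})) = D + 2 * ?p * V"
      using p(3) by (simp add: D_def V_def imbalance_eq)
    then have "order_fraction k K \<omega> = (D + 2 * ?p * V) / (2 * V - 1)"
      unfolding order_fraction_def V(2) by simp
    moreover have "(D + 2 * q * V) / (2 * V - 1) - q = (D + q) / (2 * V - 1)" for q
      using V(1) by (simp add: field_simps)
    ultimately have "order_fraction k K \<omega> - ?p = (D + ?p) / (2 * V - 1)" by simp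
    then have "\<bar>order_fraction k K \<omega> - ?p\<bar> = \<bar>D + ?p\<bar> / (2 * V - 1)"
      using V by simp
    also have "\<dots> \<le> (\<bar>D\<bar> + 1) / V"
    proof (rule frac_le)
      show "\<bar>D + ?p\<bar> \<le> \<bar>D\<bar> + 1" using p(1,2) by linarith
    qed (use V(1) in auto)
    also have "\<dots> \<le> (\<bar>D\<bar> + 1) * s"
      using True V mult_left_mono[OF True, of "\<bar>D\<bar> + 1"] by (simp add: divide_le_eq mult.assoc)
    finally have "(order_fraction k K \<omega> - ?p)\<^sup>2 \<le> ((\<bar>D\<bar> + 1) * s)\<^sup>2"
      by (metis abs_ge_zero power2_abs power_mono)
    also have "\<dots> = (\<bar>D\<bar> + 1)\<^sup>2 * s\<^sup>2" by (rule power_mult_distrib)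
    also have "\<dots> \<le> (2 * (D\<^sup>2 + 1)) * s\<^sup>2"
    proof (rule mult_right_mono)
      show "(\<bar>D\<bar> + 1)\<^sup>2 \<le> 2 * (D\<^sup>2 + 1)"
        using zero_le_power2[of "\<bar>D\<bar> - 1"] by (simp add: power2_sum power2_diff)
    qed simp
    also have "\<dots> = 2 * s\<^sup>2 * (D\<^sup>2 + 1)" by (simp only: mult_ac)
    finally have "(order_fraction k K \<omega> - ?p)\<^sup>2 \<le> 2 * s\<^sup>2 * (D\<^sup>2 + 1)" .
    moreover have "0 \<le> exp 1 * exp (- (s * V))" by simp
    ultimately show ?thesis unfolding D_def V_def by linarith
  next
    case False
    have "\<bar>order_fraction k K \<omega> - ?p\<bar> \<le> 1"
      using order_fraction_bounds[of k K \<omega>] p(1,2) by linarith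
    then have "(order_fraction k K \<omega> - ?p)\<^sup>2 \<le> 1"
      by (simp add: abs_square_le_1)
    also have "1 \<le> exp 1 * exp (- (s * V))"
      using False by (simp flip: exp_add)
    finally show ?thesis unfolding V_def by (simp add: add_increasing)
  qed
qed

lemma measurable_order_fraction [measurable]: "order_fraction k K \<in> borel_measurable clock_measure"
  unfolding order_fraction_def
  by (rule measurable_compose[OF measurable_subtree]) simp

text \<open>Take \<open>s = tail_scale / (2 * c) ^ (K - m)\<close> in the previous bound. For fixed \<open>m\<close> the contribution
  of the imbalance is of order \<open>(3 / 4) ^ K\<close>, and the lower tail of the number of leaves leaves
  an error of order \<open>tail_rate ^ (2 ^ m)\<close>, which is small for large \<open>m\<close>.\<close>

lemma expectation_order_fraction_limit:
  assumes k: "k \<ge> 1"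
  shows "(\<lambda>K. clocks.expectation (order_fraction k K)) \<longlonglongrightarrow> (1 / 2) ^ k"
proof -
  let ?p = "(1 / 2 :: real) ^ k"
  let ?x = "\<lambda>K. clocks.expectation (order_fraction k K)"
  obtain H where H: "H \<ge> 0"
    "\<And>j u. j \<ge> 1 \<Longrightarrow> clocks.moments_le (imbalance k j u) (mean_imbalance k j) (H * (3 * c\<^sup>2) ^ j)"
    using moments_le_imbalance[OF k] by blast
  obtain B where B: "B \<ge> 0" "\<And>j. \<bar>mean_imbalance k j\<bar> \<le> B"
    using mean_imbalance_bounded[OF k] by blast
  define C where "C = H + B\<^sup>2 + 1"
  have int: "integrable clock_measure (order_fraction k K)" for K
    by (rule clocks.integrable_const_bound[where B=1])
       (use order_fraction_bounds in \<open>auto intro!: AE_I2\<close>)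
  have bound: "(?x K - ?p)\<^sup>2 \<le>
      2 * (C * tail_scale\<^sup>2 * (4 * c\<^sup>2) ^ m) * (3 / 4) ^ K + exp 1 * tail_rate ^ (2 ^ m)"
    if mK: "m < K" for m K
  proof -
    define s where "s = tail_scale / (2 * c) ^ (K - m)"
    have s: "s \<ge> 0" using c_ge_1 by (simp add: s_def tail_scale_def)
    have K: "K \<ge> 1" using mK by simp
    let ?D = "imbalance k K []" and ?d = "mean_imbalance k K"
    have D: "integrable clock_measure ?D" "clocks.expectation ?D = ?d"
      "integrable clock_measure (\<lambda>\<omega>. (?D \<omega> - ?d)\<^sup>2)"
      "clocks.expectation (\<lambda>\<omega>. (?D \<omega> - ?d)\<^sup>2) \<le> H * (3 * c\<^sup>2) ^ K"
      using H(2)[OF K, of "[]"] unfolding clocks.moments_le_def by auto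
    have sq: "(?D \<omega>)\<^sup>2 = (?D \<omega> - ?d)\<^sup>2 + 2 * ?d * ?D \<omega> - ?d\<^sup>2" for \<omega>
      by (simp add: power2_eq_square algebra_simps)
    have isq: "integrable clock_measure (\<lambda>\<omega>. (?D \<omega>)\<^sup>2)"
      unfolding sq using D by simp
    have "clocks.expectation (\<lambda>\<omega>. (?D \<omega>)\<^sup>2) = clocks.expectation (\<lambda>\<omega>. (?D \<omega> - ?d)\<^sup>2) + ?d\<^sup>2"
      unfolding sq using D clocks.prob_space[unfolded space_clock_measure]
      by (simp add: power2_eq_square)
    moreover have "?d\<^sup>2 \<le> B\<^sup>2"
      using B(2)[of K] power_mono[of "\<bar>?d\<bar>" B 2] by simp
    moreover have q: "1 \<le> (3 * c\<^sup>2) ^ K"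
      using c_ge_1 one_le_power[of c 2] by (intro one_le_power) linarith
    then have "(B\<^sup>2 + 1) * 1 \<le> (B\<^sup>2 + 1) * (3 * c\<^sup>2) ^ K"
      by (intro mult_left_mono) auto
    ultimately have E2: "clocks.expectation (\<lambda>\<omega>. (?D \<omega>)\<^sup>2) + 1 \<le> C * (3 * c\<^sup>2) ^ K"
      using D(4) by (simp add: C_def distrib_right)
    have dev: "(order_fraction k K \<omega> - ?p)\<^sup>2 \<le>
        2 * s\<^sup>2 * ((?D \<omega>)\<^sup>2 + 1) + exp 1 * exp (- (s * leaves K [] \<omega>))" for \<omega>
      by (rule order_fraction_deviation[OF k K s])
    have irhs: "integrable clock_measure (\<lambda>\<omega>. 2 * s\<^sup>2 * ((?D \<omega>)\<^sup>2 + 1) + exp 1 * exp (- (s * leaves K [] \<omega>)))"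
      using isq integrable_leaves_laplace[OF s] by simp
    have ilhs: "integrable clock_measure (\<lambda>\<omega>. (order_fraction k K \<omega> - ?p)\<^sup>2)"
    proof (rule Bochner_Integration.integrable_bound[OF irhs])
      show "AE \<omega> in clock_measure. norm ((order_fraction k K \<omega> - ?p)\<^sup>2) \<le>
          norm (2 * s\<^sup>2 * ((?D \<omega>)\<^sup>2 + 1) + exp 1 * exp (- (s * leaves K [] \<omega>)))"
      proof (rule AE_I2)
        fix \<omega>
        show "norm ((order_fraction k K \<omega> - ?p)\<^sup>2) \<le>
          norm (2 * s\<^sup>2 * ((?D \<omega>)\<^sup>2 + 1) + exp 1 * exp (- (s * leaves K [] \<omega>)))"
          using order_trans[OF dev[of \<omega>] abs_ge_self] by simp
      qed
    qed measurable
    have "(?x K - ?p)\<^sup>2 \<le> clocks.expectation (\<lambda>\<omega>. (order_fraction k K \<omega> - ?p)\<^sup>2)"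
    proof -
      have "clocks.variance (order_fraction k K) =
          clocks.expectation (\<lambda>\<omega>. (order_fraction k K \<omega> - ?p)\<^sup>2) - (?x K - ?p)\<^sup>2"
      proof -
        have "(order_fraction k K \<omega> - ?x K)\<^sup>2 = (order_fraction k K \<omega> - ?p)\<^sup>2
          - 2 * (?x K - ?p) * (order_fraction k K \<omega> - ?p) + (?x K - ?p)\<^sup>2" for \<omega>
          by (simp add: power2_eq_square algebra_simps)
        then show ?thesis
          using ilhs int clocks.prob_space[unfolded space_clock_measure]
          by (simp add: power2_eq_square)
      qed
      moreover have "clocks.variance (order_fraction k K) \<ge> 0"
        by (rule Bochner_Integration.integral_nonneg) simp
      ultimately show ?thesis by linarith
    qed
    also have "\<dots> \<le> clocks.expectation (\<lambda>\<omega>. 2 * s\<^sup>2 * ((?D \<omega>)\<^sup>2 + 1) + exp 1 * exp (- (s * leaves K [] \<omega>)))"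
      by (rule integral_mono[OF ilhs irhs dev])
    also have "\<dots> = 2 * s\<^sup>2 * (clocks.expectation (\<lambda>\<omega>. (?D \<omega>)\<^sup>2) + 1) + exp 1 * leaves_laplace s K []"
      using isq integrable_leaves_laplace[OF s] clocks.prob_space[unfolded space_clock_measure]
      by (simp add: leaves_laplace_def)
    also have "\<dots> \<le> 2 * s\<^sup>2 * (C * (3 * c\<^sup>2) ^ K) + exp 1 * tail_rate ^ (2 ^ m)"
      using E2 leaves_lower_tail[OF mK] unfolding s_def
      by (intro add_mono mult_left_mono) auto
    also have "2 * s\<^sup>2 * (C * (3 * c\<^sup>2) ^ K) = 2 * (C * tail_scale\<^sup>2 * (4 * c\<^sup>2) ^ m) * (3 / 4) ^ K"
    proof -
      have "(4 * c\<^sup>2) ^ K = (4 * c\<^sup>2) ^ (K - m) * (4 * c\<^sup>2) ^ m"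
      proof -
        have "K = (K - m) + m" using mK by simp
        then show ?thesis by (metis power_add)
      qed
      moreover have "s\<^sup>2 = tail_scale\<^sup>2 / (4 * c\<^sup>2) ^ (K - m)"
        by (simp only: s_def power_divide double_power_square)
      moreover have "(3 * c\<^sup>2) ^ K = (3 / 4) ^ K * (4 * c\<^sup>2) ^ K"
      proof -
        have e: "3 / 4 * (4 * c\<^sup>2) = 3 * c\<^sup>2" by simp
        show ?thesis unfolding power_mult_distrib[symmetric] e ..
      qed
      moreover have "(4 * c\<^sup>2) ^ (K - m) \<noteq> 0" using c_ge_1 by simp
      moreover have "2 * (t / a) * (C * (r * (a * b))) = 2 * (C * t * b) * r"
        if "a \<noteq> 0" for a b r t :: real
        using that by simp
      ultimately show ?thesis by (simp only: simp_thms)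
    qed
    finally show ?thesis .
  qed
  have r: "0 \<le> tail_rate" "tail_rate < 1"
  proof -
    have "1 \<le> c\<^sup>2" using c_ge_1 by (rule one_le_power)
    then have "1 / (800 * c\<^sup>2) \<le> 1" "1 / (800 * c\<^sup>2) > 0" by (auto simp: divide_le_eq_1)
    then show "0 \<le> tail_rate" "tail_rate < 1" by (auto simp: tail_rate_def)
  qed
  have tail: "(\<lambda>m. exp 1 * tail_rate ^ (2 ^ m)) \<longlonglongrightarrow> 0"
  proof (rule Lim_null_comparison)
    show "eventually (\<lambda>m. norm (exp 1 * tail_rate ^ (2 ^ m)) \<le> exp 1 * tail_rate ^ m) sequentially"
      using r by (intro always_eventually allI)
        (auto simp: abs_mult power_decreasing less_imp_le[OF less_exp])
    show "(\<lambda>m. exp 1 * tail_rate ^ m) \<longlonglongrightarrow> 0"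
      using r by (intro tendsto_mult_right_zero LIMSEQ_power_zero) simp
  qed
  have "(\<lambda>K. (?x K - ?p)\<^sup>2) \<longlonglongrightarrow> 0"
  proof (rule LIMSEQ_I)
    fix e :: real assume e: "e > 0"
    obtain m where m: "exp 1 * tail_rate ^ (2 ^ m) < e / 2"
      using order_tendstoD(2)[OF tail, of "e / 2"] e by (auto simp: eventually_sequentially)
    have "(\<lambda>K. 2 * (C * tail_scale\<^sup>2 * (4 * c\<^sup>2) ^ m) * (3 / 4) ^ K) \<longlonglongrightarrow> 0"
      by (intro tendsto_mult_right_zero LIMSEQ_power_zero) simp
    from order_tendstoD(2)[OF this, of "e / 2"] e obtain N where
      N: "\<And>K. K \<ge> N \<Longrightarrow> 2 * (C * tail_scale\<^sup>2 * (4 * c\<^sup>2) ^ m) * (3 / 4) ^ K < e / 2"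
      by (auto simp: eventually_sequentially)
    show "\<exists>no. \<forall>K\<ge>no. norm ((?x K - ?p)\<^sup>2 - 0) < e"
    proof (intro exI[of _ "max N (Suc m)"] allI impI)
      fix K assume "K \<ge> max N (Suc m)"
      then show "norm ((?x K - ?p)\<^sup>2 - 0) < e"
        using bound[of m K] N[of K] m by simp
    qed
  qed
  then have "(\<lambda>K. sqrt ((?x K - ?p)\<^sup>2)) \<longlonglongrightarrow> sqrt 0"
    by (rule tendsto_real_sqrt)
  then have "(\<lambda>K. ?x K - ?p) \<longlonglongrightarrow> 0"
    by (simp add: tendsto_rabs_zero_iff)
  then show ?thesis by (simp add: LIM_zero_iff)
qed

end

section \<open>Conditioning on the order and the random vertex\<close>

context tokunaga
begin

definition planted_tree :: "nat \<Rightarrow> (clock \<Rightarrow> real) \<Rightarrow> rtree"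
  where "planted_tree K \<omega> = Vertex {#subtree K [] \<omega>#}"

lemma measurable_planted_tree [measurable]: "planted_tree K \<in> clock_measure \<rightarrow>\<^sub>M count_space UNIV"
  unfolding planted_tree_def by (rule measurable_compose[OF measurable_subtree]) simp

text \<open>The tree of a process started from a branch of order \<open>j\<close> has order \<open>j\<close> for every outcome, so
  that conditioning on the order of the tree amounts to fixing the order of the root branch.\<close>

lemma planted_tree_order:
  assumes "j \<ge> 1"
  shows "planted_tree j \<omega> \<in> trees_of_order K \<longleftrightarrow> j = K"
proof -
  have st: "strahler (subtree j [] \<omega>) j"
    unfolding subtree_def by (rule strahler_branch_shape[OF assms])
  have "hs_order (planted_tree j \<omega>) = j"
    using vertex_order_strahler[OF st] by (simp add: vertex_order_def planted_tree_def)
  moreover have "planted_tree j \<omega> \<in> binary_trees"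
    using strahler_binary_below[OF st] by (auto simp: binary_trees_def planted_tree_def)
  ultimately show ?thesis by (auto simp: trees_of_order_def)
qed

lemma tokunaga_measure_eq:
  "tokunaga_measure c \<gamma> = distr (hbp_space tokunaga_root_prob) (count_space UNIV)
    (\<lambda>(K, \<omega>). planted_tree K \<omega>)"
proof -
  have "tree_shape (hbp_tree (tokunaga_coeff c) (tokunaga_rate c \<gamma>) x) = (\<lambda>(K, \<omega>). planted_tree K \<omega>) x" for x
    by (cases x) (simp add: hbp_tree_def planted_tree_def subtree_def branch_shape_def)
  then show ?thesis by (simp add: tokunaga_measure_def hbp_shape_measure_def)
qed

lemma measurable_planted_tree_pair:
  "(\<lambda>(K, \<omega>). planted_tree K \<omega>) \<in> hbp_space tokunaga_root_prob \<rightarrow>\<^sub>M count_space UNIV"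
proof -
  have "(\<lambda>(K, \<omega>). planted_tree K \<omega>) \<in> count_space {1..} \<Otimes>\<^sub>M clock_measure \<rightarrow>\<^sub>M count_space UNIV"
    by (rule measurable_pair_measure_countable1) auto
  moreover have "sets (hbp_space tokunaga_root_prob) = sets (count_space {1..} \<Otimes>\<^sub>M clock_measure)"
    unfolding hbp_space_def clock_measure_def[symmetric]
    by (rule sets_pair_measure_cong) (simp_all add: sets_point_measure)
  ultimately show ?thesis by (simp cong: measurable_cong_sets)
qed

lemma emeasure_tokunaga_measure:
  assumes K: "K \<ge> 1" and A: "A \<subseteq> trees_of_order K"
  shows "emeasure (tokunaga_measure c \<gamma>) A =
    ennreal (tokunaga_root_prob K) * emeasure (distr clock_measure (count_space UNIV) (planted_tree K)) A"
proof -
  let ?P = "point_measure {1..} (\<lambda>K. ennreal (tokunaga_root_prob K))"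
  have space: "space (hbp_space tokunaga_root_prob) = {1..} \<times> UNIV"
    by (simp add: hbp_space_def clock_measure_def[symmetric] space_pair_measure space_point_measure)
  have "emeasure (tokunaga_measure c \<gamma>) A =
      emeasure (hbp_space tokunaga_root_prob) ((\<lambda>(K, \<omega>). planted_tree K \<omega>) -` A \<inter> ({1..} \<times> UNIV))"
    unfolding tokunaga_measure_eq space[symmetric]
    by (rule emeasure_distr[OF measurable_planted_tree_pair]) simp
  also have "(\<lambda>(K, \<omega>). planted_tree K \<omega>) -` A \<inter> ({1..} \<times> UNIV) = {K} \<times> (planted_tree K -` A)"
    using A K planted_tree_order by fastforce
  also have "emeasure (hbp_space tokunaga_root_prob) ({K} \<times> (planted_tree K -` A)) =
      emeasure ?P {K} * emeasure clock_measure (planted_tree K -` A)"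
    unfolding hbp_space_def clock_measure_def[symmetric]
  proof (rule clocks.emeasure_pair_measure_Times)
    show "{K} \<in> sets ?P" using K by (simp add: sets_point_measure)
    show "planted_tree K -` A \<in> clocks.events"
      using measurable_sets[OF measurable_planted_tree, of A K] by simp
  qed
  also have "emeasure ?P {K} = ennreal (tokunaga_root_prob K)"
  proof -
    have "tokunaga_root_prob K > 0" by (simp add: tokunaga_root_prob_def)
    then have "{a \<in> {K}. 0 < ennreal (tokunaga_root_prob a)} = {K}" by auto
    then show ?thesis using K by (subst emeasure_point_measure) auto
  qed
  also have "emeasure clock_measure (planted_tree K -` A) =
      emeasure (distr clock_measure (count_space UNIV) (planted_tree K)) A"
    by (subst emeasure_distr) auto
  finally show ?thesis .
qed

lemma tokunaga_measure_order_eq: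
  assumes K: "K \<ge> 1"
  shows "tokunaga_measure_order c \<gamma> K = distr clock_measure (count_space UNIV) (planted_tree K)"
proof (rule measure_eqI)
  let ?D = "distr clock_measure (count_space UNIV) (planted_tree K)"
  interpret D: prob_space ?D by (rule clocks.prob_space_distr) simp
  have sets: "sets (tokunaga_measure c \<gamma>) = UNIV" by (simp add: tokunaga_measure_eq)
  then show "sets (tokunaga_measure_order c \<gamma> K) = sets ?D"
    by (simp add: tokunaga_measure_order_def)
  fix A
  have full: "emeasure ?D (trees_of_order K \<inter> B) = emeasure ?D B" for B
    using planted_tree_order[OF K, of _ K]
    by (subst (1 2) emeasure_distr) (auto intro!: arg_cong[where f="emeasure clock_measure"])
  have "emeasure ?D (trees_of_order K) = 1"
    using full[of UNIV] D.emeasure_space_1 by simp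
  moreover have "ennreal (tokunaga_root_prob K) * x / ennreal (tokunaga_root_prob K) = x" for x
    by (subst mult.commute, rule ennreal_mult_divide_eq) (simp_all add: tokunaga_root_prob_def)
  ultimately show "emeasure (tokunaga_measure_order c \<gamma> K) A = emeasure ?D A"
    unfolding tokunaga_measure_order_def
    by (subst emeasure_uniform_measure)
       (auto simp: sets emeasure_tokunaga_measure[OF K] full)
qed

lemma mean_vertices_eq:
  assumes "k \<ge> 1" "K \<ge> 1"
  shows "mean_vertices c \<gamma> k K = mean_count c k K"
proof -
  have "mean_vertices c \<gamma> k K = clocks.expectation (\<lambda>\<omega>. real (num_vertices k (planted_tree K \<omega>)))"
    unfolding mean_vertices_def tokunaga_measure_order_eq[OF assms(2)]
    by (rule integral_distr) auto
  also have "\<dots> = mean_count c k K"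
    unfolding planted_tree_def by (rule expectation_num_vertices[OF assms])
  finally show ?thesis .
qed

lemma measure_random_vertex:
  assumes K: "K \<ge> 1"
  shows "measure (random_vertex c \<gamma> K) {v. vertex_order v = k} = clocks.expectation (order_fraction k K)"
proof -
  let ?D = "distr clock_measure (count_space UNIV) (planted_tree K)"
  let ?A = "{v. vertex_order v = k}"
  interpret D: prob_space ?D by (rule clocks.prob_space_distr) simp
  have "measure (random_vertex c \<gamma> K) ?A =
      (\<integral>t. measure (measure_pmf (pmf_of_multiset (nonroot_vertices t))) ?A \<partial>?D)"
    unfolding random_vertex_def tokunaga_measure_order_eq[OF K]
    by (rule D.measure_bind[where N="count_space UNIV"]) (auto simp: measure_pmf_in_subprob_algebra)
  also have "\<dots> = clocks.expectation
      (\<lambda>\<omega>. measure (measure_pmf (pmf_of_multiset (nonroot_vertices (planted_tree K \<omega>)))) ?A)"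
    by (rule integral_distr) auto
  also have "\<dots> = clocks.expectation (order_fraction k K)"
  proof (rule Bochner_Integration.integral_cong[OF refl])
    fix \<omega>
    have "measure (measure_pmf (pmf_of_multiset N)) ?A = real (size {#v \<in># N. vertex_order v = k#}) / real (size N)"
      if N: "N \<noteq> {#}" for N :: "rtree multiset"
    proof -
      have "measure (measure_pmf (pmf_of_multiset N)) ?A =
          measure (measure_pmf (pmf_of_multiset N)) (?A \<inter> set_mset N)"
        using measure_Int_set_pmf[of "pmf_of_multiset N" ?A] N by simp
      also have "\<dots> = (\<Sum>v\<in>?A \<inter> set_mset N. real (count N v) / real (size N))"
        using N by (subst measure_measure_pmf_finite) auto
      also have "\<dots> = real (\<Sum>v\<in>?A \<inter> set_mset N. count N v) / real (size N)"
        by (simp add: sum_divide_distrib)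
      also have "(\<Sum>v\<in>?A \<inter> set_mset N. count N v) = size {#v \<in># N. vertex_order v = k#}"
        unfolding size_multiset_overloaded_eq by (rule sum.cong) auto
      finally show ?thesis .
    qed
    moreover have "nonroot_vertices (planted_tree K \<omega>) \<noteq> {#}" by (simp add: planted_tree_def)
    ultimately show "measure (measure_pmf (pmf_of_multiset (nonroot_vertices (planted_tree K \<omega>)))) ?A =
        order_fraction k K \<omega>"
      by (simp add: order_fraction_def num_vertices_def planted_tree_def)
  qed
  finally show ?thesis .
qed

end

theorem proposition11:
  fixes \<gamma> c :: real
  assumes "\<gamma> > 0" and "c \<ge> 1"
  shows "(\<forall>k\<ge>1. (\<lambda>K. mean_vertices c \<gamma> k K / mean_vertices c \<gamma> 1 K)
             \<longlonglongrightarrow> 2 powi (1 - int k))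
       \<and> (\<forall>k\<ge>1. (\<lambda>K. measure (random_vertex c \<gamma> K) {v. vertex_order v = k})
             \<longlonglongrightarrow> tokunaga_root_prob k
           \<and> tokunaga_root_prob k = 2 powi (- int k))"
proof -
  interpret tokunaga c \<gamma> using assms by unfold_locales
  have half: "(1 / 2 :: real) ^ n = 2 powi (- int n)" for n
    by (simp add: power_int_minus power_one_over inverse_eq_divide)
  have "(\<lambda>K. mean_vertices c \<gamma> k K / mean_vertices c \<gamma> 1 K) \<longlonglongrightarrow> 2 powi (1 - int k)" if k: "k \<ge> 1" for k
  proof -
    have ev: "eventually (\<lambda>K. mean_count c k K / mean_count c 1 K =
        mean_vertices c \<gamma> k K / mean_vertices c \<gamma> 1 K) sequentially"
      using eventually_ge_at_top[of 1] by eventually_elim (simp only: mean_vertices_eq[OF k] mean_vertices_eq[OF order_refl])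
    have "(1 / 2 :: real) ^ (k - 1) = 2 powi (1 - int k)"
      unfolding half using k by (simp add: of_nat_diff)
    then show ?thesis
      using Lim_transform_eventually[OF mean_ratio_limit[OF k] ev] by (simp only:)
  qed
  moreover have "(\<lambda>K. measure (random_vertex c \<gamma> K) {v. vertex_order v = k}) \<longlonglongrightarrow> tokunaga_root_prob k"
    if k: "k \<ge> 1" for k
  proof -
    have "eventually (\<lambda>K. clocks.expectation (order_fraction k K) =
        measure (random_vertex c \<gamma> K) {v. vertex_order v = k}) sequentially"
      using eventually_ge_at_top[of 1] by eventually_elim (simp add: measure_random_vertex)
    then show ?thesis
      using expectation_order_fraction_limit[OF k] unfolding half tokunaga_root_prob_def
      by (rule Lim_transform_eventually[rotated])
  qed
  ultimately show ?thesis by (simp add: tokunaga_root_prob_def)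
qed

end
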